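(* Let $\mathbf M=\{M_k\}_{k\in\mathbb Z}$ be a sequence of Orlicz functions whose conjugate sequence $\mathbf M^*=\{M_k^*\}_{k\in\mathbb Z}$ satisfies $M_k^*(v)>M_k^*(1)=1$ for all $v>1$ and all $k\in\mathbb Z$. Let $\psi\in\Psi$. Let $\varphi\in\Phi$ be non-decreasing on a certain interval $[0,a]$, $a>0$, with $\varphi(a)=\sup\{\varphi(t):t\in\mathbb R\}$. Let $\tau\in(0,a]$, $\mu\in\mathcal M(\tau)$, and let $\Omega(u)$ be a fixed continuous monotonically increasing function of $u\ge 0$ with $\Omega(0)=0$ such that for all $\xi>0$ and $0<u\le a$ $$\Omega\Big(\frac u\xi\Big)\int_0^{\xi\tau}\varphi_*(t)\,d\mu\Big(\frac t\xi\Big)\le\Omega(u)\int_0^\tau\varphi(t)\,d\mu(t),$$ where $\varphi_*(t):=\varphi(t)$ for $0\le t\le a$ and $\varphi_*(t):=\varphi(a)$ for $t\ge a$. Then for every $n\in\mathbb N$ and $N\in\{2n-1,2n\}$, $$\frac{\mu(\tau)-\mu(0)}{\int_0^\tau\varphi(t)\,d\mu(t)}\,|\psi(n)|\,\Omega\Big(\frac\tau n\Big)\le P_N\Big(L^\psi(\varphi,\tau,\mu,\Omega)^*_{\mathbf M},\mathcal S_{\mathbf M}\Big)\le\frac{\mu(\tau)-\mu(0)}{I_{n,\varphi}(\tau,\mu)}\,|\psi(n)|\,\Omega\Big(\frac\tau n\Big),$$ where $$I_{n,\varphi}(\tau,\mu):=\inf_{k\in\mathbb N,\ k\ge n}\int_0^{\tau}\varphi\Big(\frac{kt}{n}\Big)\,d\mu(t)$$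 and $P_N$ is any of the widths $b_N$, $d_N$, $\lambda_N$ or $\pi_N$ (Bernstein, Kolmogorov, linear, projection). If, in addition, $I_{n,\varphi}(\tau,\mu)=\int_0^\tau\varphi(t)\,d\mu(t)$, then $$P_N\Big(L^\psi(\varphi,\tau,\mu,\Omega)^*_{\mathbf M},\mathcal S_{\mathbf M}\Big)=\frac{\mu(\tau)-\mu(0)}{\int_0^\tau\varphi(t)\,d\mu(t)}\,|\psi(n)|\,\Omega\Big(\frac\tau n\Big).$$
   Context: $L$ is the space of $2\pi$-periodic complex-valued Lebesgue summable functions, with Fourier coefficients $\widehat f(k)=(2\pi)^{-1}\int_0^{2\pi}f(x)e^{-ikx}\,dx$, $k\in\mathbb Z$. Spaces and norm. An Orlicz function is a nondecreasing convex function $M(t)$, $t\ge 0$, with $M(0)=0$ and $M(t)\to\infty$ as $t\to\infty$. For a sequence $\mathbf M=\{M_k\}_{k\in\mathbb Z}$ of Orlicz functions, $\mathcal S_{\mathbf M}$ is the space of all $f\in L$ such that $\inf\{a>0:\sum_{k\in\mathbb Z}M_k(|\widehat f(k)|/a)\le 1\}<\infty$. The conjugate sequence is $M_k^*(v):=\sup\{uv-M_k(u):u\ge 0\}$, $v\ge 0$. $\Lambda$ is the set of sequences $\lambda=\{\lambda_k\}_{k\in\mathbb Z}$ of positive numbers with $\sum_{k\in\mathbb Z}M_k^*(\lambda_k)\le 1$. The Orlicz norm of a complex sequence $\{c_k\}_{k\in\mathbb Z}$ is $\sup\{\sum_{k\in\mathbb Z}\lambda_k|c_k|:\lambda\in\Lambda\}$,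 and $\|f\|^*_{\mathbf M}$ denotes the Orlicz norm of $\{\widehat f(k)\}_{k\in\mathbb Z}$, $f\in\mathcal S_{\mathbf M}$. Generalized modulus of smoothness. $\Phi$ is the set of all continuous bounded nonnegative even functions $\varphi$ on $\mathbb R$ with $\varphi(0)=0$ such that $\{t\in\mathbb R:\varphi(t)=0\}$ has Lebesgue measure zero. For $\varphi\in\Phi$, $h\in\mathbb R$, $f\in\mathcal S_{\mathbf M}$, $\|\Delta_h^\varphi f\|^*_{\mathbf M}$ denotes the Orlicz norm of the sequence $\{\varphi(kh)\widehat f(k)\}_{k\in\mathbb Z}$, and $\omega_\varphi(f,t)^*_{\mathbf M}:=\sup_{|h|\le t}\|\Delta_h^\varphi f\|^*_{\mathbf M}$. For $\tau>0$, $\mathcal M(\tau)$ is the set of all bounded non-decreasing non-constant functions $\mu$ on $[0,\tau]$. For $\mu\in\mathcal M(\tau)$ and $u>0$, $$\Omega_\varphi(f,\tau,\mu,u)^*_{\mathbf M}:=\frac{1}{\mu(\tau)-\mu(0)}\int_0^u\omega_\varphi(f,t)^*_{\mathbf M}\,d\mu\Big(\frac{\tau t}{u}\Big),$$ the integrals with respect to $\mu$ being Stieltjes integrals. $\psi$-derivatives and classes. Let $\psi=\{\psi(k)\}_{k\in\mathbb Z}$ be an arbitrary sequence of complex numbers. If $g\in L$ and $F\in L$ satisfy $\widehat F(k)=\psi(k)\widehat g(k)$ for all $k\in\mathbb Z$, then $F$ is called the $\psi$-integral of $g$, and $g=:F^\psi$ is called the $\psi$-derivative of $F$. $L^\psi\mathcal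 S_{\mathbf M}$ is the set of all $\psi$-integrals of functions from $\mathcal S_{\mathbf M}$. $\Psi$ is the set of sequences $\psi$ of complex numbers with $|\psi(k)|=|\psi(-k)|\ge|\psi(k+1)|$ for all $k\in\mathbb N=\{1,2,\dots\}$. The class determined by the majorant $\Omega$ is $$L^\psi(\varphi,\tau,\mu,\Omega)^*_{\mathbf M}:=\Big\{f\in L^\psi\mathcal S_{\mathbf M}:\ \Omega_\varphi(f^\psi,\tau,\mu,u)^*_{\mathbf M}\le\Omega(u),\ 0< u\le\tau\Big\}.$$ Widths. Let $K\subset\mathcal S_{\mathbf M}$ be convex and centrally symmetric, and let $B^*_{\mathbf M}$ be the unit ball of $\mathcal S_{\mathbf M}$ for $\|\cdot\|^*_{\mathbf M}$. $F_N$ ranges over $N$-dimensional subspaces of $\mathcal S_{\mathbf M}$; $\mathscr L(\mathcal S_{\mathbf M},F_N)$ is the set of linear operators from $\mathcal S_{\mathbf M}$ to $F_N$, and $\mathscr P(\mathcal S_{\mathbf M},F_N)$ its subset of projections onto $F_N$, i.e. operators $A$ with $Af=f$ for $f\in F_N$. Then $$b_N(K,\mathcal S_{\mathbf M})=\sup_{F_{N+1}}\sup\{\varepsilon>0:\varepsilon B^*_{\mathbf M}\cap F_{N+1}\subset K\},\qquad d_N(K,\mathcal S_{\mathbf M})=\inf_{F_N}\sup_{f\in K}\inf_{u\in F_N}\|f-u\|^*_{\mathbf M},$$ $$\lambda_N(K,\mathcal S_{\mathbf M})=\inf_{F_N}\inf_{A\in\mathscr L(\mathcal S_{\mathbf M},F_N)}\sup_{f\in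 K}\|f-Af\|^*_{\mathbf M},\qquad \pi_N(K,\mathcal S_{\mathbf M})=\inf_{F_N}\inf_{A\in\mathscr P(\mathcal S_{\mathbf M},F_N)}\sup_{f\in K}\|f-Af\|^*_{\mathbf M}.$$
   Formalization: For N=2n the lower bound and the equality are stated only when ψ(0)≠0; if ψ(0)=0 and ψ(k)=0 for |k|>n, the class lies in a 2n-dimensional space and its widths vanish. "Monotonically increasing" Ω is read as strictly increasing. *)

theory Defs
  imports "HOL-Analysis.Analysis"
begin

section \<open>The space of summable \<open>2\<pi>\<close>-periodic functions\<close>

definition summable_periodic :: "(real \<Rightarrow> complex) set" where
  "summable_periodic =
     {f. (\<forall>x. f (x + 2 * pi) = f x) \<and> set_integrable lebesgue {0..2 * pi} f}"

text \<open>Functions that agree almost everywhere are identified, so that dimensions of subspaces of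
  this type are the usual ones.\<close>

quotient_type per_L1 = "real \<Rightarrow> complex" / partial:
  "\<lambda>f g. f \<in> summable_periodic \<and> g \<in> summable_periodic \<and> (AE x in lebesgue. f x = g x)"
proof (rule part_equivpI)
  have "(\<lambda>x. 0) \<in> summable_periodic"
    by (simp add: summable_periodic_def set_integrable_def)
  then show "\<exists>f. f \<in> summable_periodic \<and> f \<in> summable_periodic \<and> (AE x in lebesgue. f x = f x)"
    by auto
qed (auto intro!: sympI transpI)

instantiation per_L1 :: ab_group_add
begin

lift_definition zero_per_L1 :: per_L1 is "\<lambda>x. 0"
  by (simp add: summable_periodic_def set_integrable_def)

lift_definition plus_per_L1 :: "per_L1 \<Rightarrow> per_L1 \<Rightarrow> per_L1" is "\<lambda>f g x. f x + g x"
  by (auto simp: summable_periodic_def)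

lift_definition minus_per_L1 :: "per_L1 \<Rightarrow> per_L1 \<Rightarrow> per_L1" is "\<lambda>f g x. f x - g x"
  by (auto simp: summable_periodic_def)

lift_definition uminus_per_L1 :: "per_L1 \<Rightarrow> per_L1" is "\<lambda>f x. - f x"
  by (auto simp: summable_periodic_def set_integrable_def)

instance
proof
  fix a b c :: per_L1
  show "a + b + c = a + (b + c)"
    by transfer (auto simp: summable_periodic_def algebra_simps)
  show "a + b = b + a"
    by transfer (auto simp: summable_periodic_def algebra_simps)
  show "0 + a = a"
    by transfer (auto simp: summable_periodic_def)
  show "- a + a = 0"
    by transfer (auto simp: summable_periodic_def set_integrable_def)
  show "a - b = a + - b"
    by transfer (auto simp: summable_periodic_def)
qed

end

lift_definition scale_L1 :: "complex \<Rightarrow> per_L1 \<Rightarrow> per_L1" is "\<lambda>c f x. c * f x"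
  by (auto simp: summable_periodic_def)

global_interpretation L1: vector_space scale_L1
proof
  fix a b :: complex and x y :: per_L1
  show "scale_L1 a (x + y) = scale_L1 a x + scale_L1 a y"
    by transfer (auto simp: summable_periodic_def algebra_simps)
  show "scale_L1 (a + b) x = scale_L1 a x + scale_L1 b x"
    by transfer (auto simp: summable_periodic_def algebra_simps)
  show "scale_L1 a (scale_L1 b x) = scale_L1 (a * b) x"
    by transfer (auto simp: summable_periodic_def algebra_simps)
  show "scale_L1 1 x = x"
    by transfer (auto simp: summable_periodic_def)
qed

lift_definition fourier_coeff :: "per_L1 \<Rightarrow> int \<Rightarrow> complex" is
  "\<lambda>f k. 1 / (2 * pi) *
     (LINT x:{0..2 * pi}|lebesgue. f x * exp (- (\<i> * of_int k * complex_of_real x)))"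
proof -
  fix f g :: "real \<Rightarrow> complex"
  let ?e = "\<lambda>k x. exp (- (\<i> * of_int k * complex_of_real x))"
  assume *: "f \<in> summable_periodic \<and> g \<in> summable_periodic \<and> (AE x in lebesgue. f x = g x)"
  have meas: "(\<lambda>x. indicat_real {0..2 * pi} x *\<^sub>R (h x * ?e k x)) \<in> borel_measurable lebesgue"
    if "h \<in> summable_periodic" for h :: "real \<Rightarrow> complex" and k :: int
  proof -
    have 1: "(\<lambda>x. indicat_real {0..2 * pi} x *\<^sub>R h x) \<in> borel_measurable lebesgue"
      using that by (auto simp: summable_periodic_def set_integrable_def)
    have "continuous_on UNIV (?e k)"
      by (intro continuous_intros)
    then have "?e k \<in> borel_measurable borel"
      by (rule borel_measurable_continuous_onI)
    then have 2: "?e k \<in> borel_measurable lebesgue"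
      by (simp add: measurable_completion)
    show ?thesis
      using borel_measurable_times[OF 1 2] by simp
  qed
  show "(\<lambda>k. 1 / (2 * pi) * (LINT x:{0..2 * pi}|lebesgue. f x * ?e k x)) =
        (\<lambda>k. 1 / (2 * pi) * (LINT x:{0..2 * pi}|lebesgue. g x * ?e k x))"
  proof
    fix k
    have "(LINT x:{0..2 * pi}|lebesgue. f x * ?e k x) = (LINT x:{0..2 * pi}|lebesgue. g x * ?e k x)"
      unfolding set_lebesgue_integral_def
      using * by (intro integral_cong_AE meas) auto
    then show "1 / (2 * pi) * (LINT x:{0..2 * pi}|lebesgue. f x * ?e k x) =
        1 / (2 * pi) * (LINT x:{0..2 * pi}|lebesgue. g x * ?e k x)"
      by simp
  qed
qed

section \<open>Orlicz type sequence spaces\<close>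

definition orlicz_function :: "(real \<Rightarrow> real) \<Rightarrow> bool" where
  "orlicz_function M \<longleftrightarrow>
     mono_on {0..} M \<and> convex_on {0..} M \<and> M 0 = 0 \<and> filterlim M at_top at_top"

definition orlicz_space :: "(int \<Rightarrow> real \<Rightarrow> real) \<Rightarrow> per_L1 set" where
  "orlicz_space M =
     {f. (INF a\<in>{a. 0 < a \<and> (\<Sum>\<^sub>\<infinity>k. ennreal (M k (cmod (fourier_coeff f k) / a))) \<le> 1}.
            ennreal a) < \<infinity>}"

text \<open>The conjugate may take the value \<open>\<infinity>\<close>. As \<open>M 0 = 0\<close> for an Orlicz function, the supremum is
  nonnegative, so truncating negative terms in \<open>ennreal\<close> does not change it.\<close>

definition conjugate :: "(real \<Rightarrow> real) \<Rightarrow> real \<Rightarrow> ennreal" where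
  "conjugate M v = (SUP u\<in>{0..}. ennreal (u * v - M u))"

definition dual_sequences :: "(int \<Rightarrow> real \<Rightarrow> real) \<Rightarrow> (int \<Rightarrow> real) set" where
  "dual_sequences M = {l. (\<forall>k. 0 < l k) \<and> (\<Sum>\<^sub>\<infinity>k. conjugate (M k) (l k)) \<le> 1}"

definition orlicz_norm_seq :: "(int \<Rightarrow> real \<Rightarrow> real) \<Rightarrow> (int \<Rightarrow> complex) \<Rightarrow> ennreal" where
  "orlicz_norm_seq M c = (SUP l\<in>dual_sequences M. \<Sum>\<^sub>\<infinity>k. ennreal (l k * cmod (c k)))"

definition orlicz_norm :: "(int \<Rightarrow> real \<Rightarrow> real) \<Rightarrow> per_L1 \<Rightarrow> ennreal" where
  "orlicz_norm M f = orlicz_norm_seq M (fourier_coeff f)"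

section \<open>Stieltjes integrals\<close>

text \<open>The Lebesgue--Stieltjes integral of \<open>f \<ge> 0\<close> over the closed interval \<open>[a, b]\<close> with respect to
  a function \<open>g\<close> that is nondecreasing on \<open>[a, b]\<close>. Only the values of \<open>g\<close> on \<open>[a, b]\<close> matter:
  \<open>g\<close> is extended by constants and made right-continuous, as \<^const>\<open>interval_measure\<close> requires.
  A jump of \<open>g\<close> at \<open>a\<close> or at \<open>b\<close> contributes the atom \<open>g(a+) - g(a)\<close> or \<open>g(b) - g(b-)\<close>, as it does
  for the Riemann--Stieltjes integral, with which this integral agrees whenever the latter
  exists. For monotone \<open>f\<close>, such as a modulus of smoothness, the latter need not exist.\<close>

definition right_cont_ext :: "(real \<Rightarrow> real) \<Rightarrow> real \<Rightarrow> real \<Rightarrow> real \<Rightarrow> real" where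
  "right_cont_ext g a b x =
     (if x < a then g a else if x < b then (INF y\<in>{x<..b}. g y) else g b)"

definition stieltjes_integral ::
    "real \<Rightarrow> real \<Rightarrow> (real \<Rightarrow> ennreal) \<Rightarrow> (real \<Rightarrow> real) \<Rightarrow> ennreal" where
  "stieltjes_integral a b f g =
     (\<integral>\<^sup>+t\<in>{a..b}. f t \<partial>interval_measure (right_cont_ext g a b))"

section \<open>Generalized moduli of smoothness\<close>

definition Phi_set :: "(real \<Rightarrow> real) set" where
  "Phi_set = {\<phi>. continuous_on UNIV \<phi> \<and> bounded (range \<phi>) \<and> (\<forall>t. 0 \<le> \<phi> t) \<and>
     (\<forall>t. \<phi> (- t) = \<phi> t) \<and> \<phi> 0 = 0 \<and> {t. \<phi> t = 0} \<in> null_sets lebesgue}"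

definition Delta_norm ::
    "(int \<Rightarrow> real \<Rightarrow> real) \<Rightarrow> (real \<Rightarrow> real) \<Rightarrow> real \<Rightarrow> per_L1 \<Rightarrow> ennreal" where
  "Delta_norm M \<phi> h f =
     orlicz_norm_seq M (\<lambda>k. complex_of_real (\<phi> (of_int k * h)) * fourier_coeff f k)"

definition modulus ::
    "(int \<Rightarrow> real \<Rightarrow> real) \<Rightarrow> (real \<Rightarrow> real) \<Rightarrow> per_L1 \<Rightarrow> real \<Rightarrow> ennreal" where
  "modulus M \<phi> f t = (SUP h\<in>{h. \<bar>h\<bar> \<le> t}. Delta_norm M \<phi> h f)"

definition weight_functions :: "real \<Rightarrow> (real \<Rightarrow> real) set" where
  "weight_functions \<tau> =
     {\<mu>. bounded (\<mu> ` {0..\<tau>}) \<and> mono_on {0..\<tau>} \<mu> \<and> \<not> \<mu> constant_on {0..\<tau>}}"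

definition mean_modulus ::
    "(int \<Rightarrow> real \<Rightarrow> real) \<Rightarrow> (real \<Rightarrow> real) \<Rightarrow> per_L1 \<Rightarrow> real \<Rightarrow> (real \<Rightarrow> real) \<Rightarrow> real \<Rightarrow> ennreal"
  where
  "mean_modulus M \<phi> f \<tau> \<mu> u =
     1 / ennreal (\<mu> \<tau> - \<mu> 0) *
     stieltjes_integral 0 u (modulus M \<phi> f) (\<lambda>t. \<mu> (\<tau> * t / u))"

section \<open>Classes of functions with a \<open>\<psi>\<close>-derivative\<close>

definition psi_integral_of :: "(int \<Rightarrow> complex) \<Rightarrow> per_L1 \<Rightarrow> per_L1 \<Rightarrow> bool" where
  "psi_integral_of \<psi> g F \<longleftrightarrow> (\<forall>k. fourier_coeff F k = \<psi> k * fourier_coeff g k)"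

definition Psi_set :: "(int \<Rightarrow> complex) set" where
  "Psi_set =
     {\<psi>. \<forall>k\<ge>1. cmod (\<psi> k) = cmod (\<psi> (- k)) \<and> cmod (\<psi> (- k)) \<ge> cmod (\<psi> (k + 1))}"

text \<open>If \<open>\<psi>\<close> has zeros, the \<open>\<psi>\<close>-derivative of \<open>f\<close> is not unique; \<open>f\<close> belongs to the class if
  one of its \<open>\<psi>\<close>-derivatives in the Orlicz space satisfies the bound.\<close>

definition psi_class ::
    "(int \<Rightarrow> real \<Rightarrow> real) \<Rightarrow> (int \<Rightarrow> complex) \<Rightarrow> (real \<Rightarrow> real) \<Rightarrow> real \<Rightarrow> (real \<Rightarrow> real) \<Rightarrow>
     (real \<Rightarrow> real) \<Rightarrow> per_L1 set" where
  "psi_class M \<psi> \<phi> \<tau> \<mu> \<Omega> =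
     {f. \<exists>g\<in>orlicz_space M. psi_integral_of \<psi> g f \<and>
           (\<forall>u. 0 < u \<and> u \<le> \<tau> \<longrightarrow> mean_modulus M \<phi> g \<tau> \<mu> u \<le> ennreal (\<Omega> u))}"

section \<open>Widths\<close>

text \<open>The widths are elements of \<open>[0, \<infinity>]\<close>; in particular, the supremum of the empty set is \<open>0\<close>.\<close>

definition orlicz_ball :: "(int \<Rightarrow> real \<Rightarrow> real) \<Rightarrow> per_L1 set" where
  "orlicz_ball M = {f \<in> orlicz_space M. orlicz_norm M f \<le> 1}"

definition subspaces_of_dim :: "(int \<Rightarrow> real \<Rightarrow> real) \<Rightarrow> nat \<Rightarrow> per_L1 set set" where
  "subspaces_of_dim M N =
     {F. F \<subseteq> orlicz_space M \<and>
         (\<exists>B. finite B \<and> card B = N \<and> L1.independent B \<and> L1.span B = F)}"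

definition linear_operators ::
    "(int \<Rightarrow> real \<Rightarrow> real) \<Rightarrow> per_L1 set \<Rightarrow> (per_L1 \<Rightarrow> per_L1) set" where
  "linear_operators M F =
     {A. (\<forall>f\<in>orlicz_space M. A f \<in> F) \<and>
         (\<forall>f\<in>orlicz_space M. \<forall>g\<in>orlicz_space M. A (f + g) = A f + A g) \<and>
         (\<forall>c. \<forall>f\<in>orlicz_space M. A (scale_L1 c f) = scale_L1 c (A f))}"

definition projections ::
    "(int \<Rightarrow> real \<Rightarrow> real) \<Rightarrow> per_L1 set \<Rightarrow> (per_L1 \<Rightarrow> per_L1) set" where
  "projections M F = {A \<in> linear_operators M F. \<forall>f\<in>F. A f = f}"

definition bernstein_width ::
    "(int \<Rightarrow> real \<Rightarrow> real) \<Rightarrow> nat \<Rightarrow> per_L1 set \<Rightarrow> ennreal" where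
  "bernstein_width M N K =
     (SUP F\<in>subspaces_of_dim M (N + 1).
        SUP \<epsilon>\<in>{\<epsilon>. 0 < \<epsilon> \<and> scale_L1 (complex_of_real \<epsilon>) ` orlicz_ball M \<inter> F \<subseteq> K}. ennreal \<epsilon>)"

definition kolmogorov_width ::
    "(int \<Rightarrow> real \<Rightarrow> real) \<Rightarrow> nat \<Rightarrow> per_L1 set \<Rightarrow> ennreal" where
  "kolmogorov_width M N K =
     (INF F\<in>subspaces_of_dim M N. SUP f\<in>K. INF u\<in>F. orlicz_norm M (f - u))"

definition linear_width ::
    "(int \<Rightarrow> real \<Rightarrow> real) \<Rightarrow> nat \<Rightarrow> per_L1 set \<Rightarrow> ennreal" where
  "linear_width M N K =
     (INF F\<in>subspaces_of_dim M N. INF A\<in>linear_operators M F. SUP f\<in>K. orlicz_norm M (f - A f))"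

definition projection_width ::
    "(int \<Rightarrow> real \<Rightarrow> real) \<Rightarrow> nat \<Rightarrow> per_L1 set \<Rightarrow> ennreal" where
  "projection_width M N K =
     (INF F\<in>subspaces_of_dim M N. INF A\<in>projections M F. SUP f\<in>K. orlicz_norm M (f - A f))"

section \<open>Quantities in the estimates\<close>

definition phi_star :: "(real \<Rightarrow> real) \<Rightarrow> real \<Rightarrow> real \<Rightarrow> real" where
  "phi_star \<phi> a t = (if t \<le> a then \<phi> t else \<phi> a)"

definition I_inf :: "nat \<Rightarrow> (real \<Rightarrow> real) \<Rightarrow> real \<Rightarrow> (real \<Rightarrow> real) \<Rightarrow> ennreal" where
  "I_inf n \<phi> \<tau> \<mu> =
     (INF k\<in>{n..}. stieltjes_integral 0 \<tau> (\<lambda>t. ennreal (\<phi> (real k * t / real n))) \<mu>)"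

end

theory Submission
  imports Defs
begin

text \<open>
  The Orlicz norm is a lattice norm on the sequence of Fourier coefficients: it is monotone in the
  moduli of the coefficients, and the condition on the conjugates makes it dominate each of them.
  Consequently the partial sums of the Fourier series are contractions, and all four widths can
  be estimated by means of subspaces that are spanned by exponentials.

  Upper bounds. The part of a function of the class with frequencies \<open>\<bar>k\<bar> \<ge> n\<close> has norm at most the
  stated bound (\<open>psi_class_tail_le\<close>): average the inequality between the norm of a difference
  and the modulus of smoothness with respect to \<open>\<mu>\<close> at \<open>u = \<tau> / n\<close>. Approximation by a partial sum
  with \<open>N\<close> frequencies containing all \<open>\<bar>k\<bar> < n\<close> therefore bounds the projection width, and with
  it the linear and the Kolmogorov width. For the Bernstein width, a subspace of dimension
  \<open>N + 1\<close> contains a nonzero function without the frequencies \<open>\<bar>k\<bar> < n\<close>; as nonzero functions have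
  positive norm by the uniqueness theorem for Fourier coefficients, its multiple on the sphere of
  an admissible ball shows that the radius is at most the same bound (\<open>bernstein_width_le\<close>).

  Lower bounds. A ball of the radius given by the lower bound in the space of trigonometric
  polynomials with \<open>N + 1\<close> frequencies \<open>\<bar>k\<bar> \<le> n\<close> lies in the class (\<open>ball_subset_psi_class\<close>),
  because the multiplier \<open>\<phi>(k h)\<close> is at most \<open>phi_star(n \<bar>h\<bar>)\<close> and the hypothesis on the majorant
  is made for this estimate. This bounds the Bernstein width by definition, and the Kolmogorov
  width since the ball of a coordinate subspace of dimension \<open>N + 1\<close> cannot be approximated
  better than by its radius from a subspace of dimension \<open>N\<close>. That fact is elementary here
  (\<open>le_kolmogorov_width\<close>), because the coordinate projection is a contraction.
\<close>

section \<open>Homogeneous linear systems\<close>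

text \<open>Gaussian elimination: a row \<open>b\<close> with pivot \<open>t\<close> removes the unknown \<open>t\<close> from all other rows.\<close>

lemma homogeneous_system_nontrivial:
  fixes m :: "'b \<Rightarrow> 'a \<Rightarrow> 'c::field"
  assumes "finite B" "finite T" "card B < card T"
  shows "\<exists>a. (\<exists>k\<in>T. a k \<noteq> 0) \<and> (\<forall>b\<in>B. (\<Sum>k\<in>T. a k * m b k) = 0)"
  using assms
proof (induction B arbitrary: T m rule: finite_induct)
  case empty
  then have "T \<noteq> {}" by auto
  then show ?case by (intro exI[of _ "\<lambda>_. 1"]) auto
next
  case (insert b B)
  show ?case
  proof (cases "\<forall>k\<in>T. m b k = 0")
    case True
    obtain a where "\<exists>k\<in>T. a k \<noteq> 0" "\<forall>b\<in>B. (\<Sum>k\<in>T. a k * m b k) = 0"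
      using insert.IH[of T m] insert.prems insert.hyps by auto
    then show ?thesis using True by (intro exI[of _ a]) auto
  next
    case False
    then obtain t where t: "t \<in> T" "m b t \<noteq> 0" by auto
    define S where "S = T - {t}"
    have S: "finite S" "t \<notin> S" "T = insert t S" "card B < card S"
      using t insert.prems insert.hyps by (auto simp: S_def)
    obtain a where a: "\<exists>k\<in>S. a k \<noteq> 0"
        "\<And>b'. b' \<in> B \<Longrightarrow> (\<Sum>k\<in>S. a k * (m b' k - m b' t / m b t * m b k)) = 0"
      using insert.IH[OF S(1,4), of "\<lambda>b' k. m b' k - m b' t / m b t * m b k"] by blast
    define a' where "a' = a(t := - (\<Sum>k\<in>S. a k * m b k) / m b t)"
    have eq: "(\<Sum>k\<in>T. a' k * m b' k) = a' t * m b' t + (\<Sum>k\<in>S. a k * m b' k)" for b'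
      using S by (auto simp: a'_def intro!: sum.cong)
    have "(\<Sum>k\<in>T. a' k * m b k) = 0"
      unfolding eq using t by (simp add: a'_def)
    moreover have "(\<Sum>k\<in>T. a' k * m b' k) = 0" if "b' \<in> B" for b'
    proof -
      have "(\<Sum>k\<in>S. a k * (m b' k - m b' t / m b t * m b k))
          = (\<Sum>k\<in>S. a k * m b' k) - m b' t / m b t * (\<Sum>k\<in>S. a k * m b k)"
        by (simp add: right_diff_distrib sum_subtractf sum_distrib_left mult_ac)
      then show ?thesis
        unfolding eq using a(2)[OF that] by (simp add: a'_def)
    qed
    moreover have "\<exists>k\<in>T. a' k \<noteq> 0" using a(1) S by (auto simp: a'_def)
    ultimately show ?thesis by (intro exI[of _ a']) auto
  qed
qed

section \<open>Fourier coefficients and exponentials\<close>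

lemma integrable_times_bounded:
  fixes f h :: "real \<Rightarrow> complex"
  assumes "set_integrable lebesgue S f" and "h \<in> borel_measurable lebesgue"
    and "\<And>x. cmod (h x) \<le> 1"
  shows "set_integrable lebesgue S (\<lambda>x. f x * h x)"
proof -
  have "(\<lambda>x. (indicat_real S x *\<^sub>R f x) * h x) \<in> borel_measurable lebesgue"
    using assms(1,2) by (intro borel_measurable_times) (auto simp: set_integrable_def)
  then have "integrable lebesgue (\<lambda>x. (indicat_real S x *\<^sub>R f x) * h x)"
    by (rule Bochner_Integration.integrable_bound[OF assms(1)[unfolded set_integrable_def]])
      (auto simp: norm_mult indicator_def mult_left_le[OF assms(3)])
  then show ?thesis by (simp add: set_integrable_def)
qed

lemma continuous_imp_lebesgue_measurable:
  fixes h :: "real \<Rightarrow> 'b::topological_space"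
  assumes "continuous_on UNIV h"
  shows "h \<in> borel_measurable lebesgue"
  using borel_measurable_continuous_onI[OF assms] by (simp add: measurable_completion)

lemma summable_periodic_times_exp:
  assumes "f \<in> summable_periodic"
  shows "set_integrable lebesgue {0..2 * pi} (\<lambda>x. f x * exp (- (\<i> * of_int k * complex_of_real x)))"
proof (rule integrable_times_bounded)
  show "(\<lambda>x. exp (- (\<i> * of_int k * complex_of_real x))) \<in> borel_measurable lebesgue"
    by (intro continuous_imp_lebesgue_measurable continuous_intros)
qed (use assms in \<open>auto simp: summable_periodic_def norm_exp_eq_Re\<close>)

lemma fourier_coeff_add:
  "fourier_coeff (f + g) k = fourier_coeff f k + fourier_coeff g k"
  by (transfer fixing: k)
    (simp add: ring_distribs set_integral_add summable_periodic_times_exp)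

lemma fourier_coeff_diff:
  "fourier_coeff (f - g) k = fourier_coeff f k - fourier_coeff g k"
  by (transfer fixing: k)
    (simp add: ring_distribs set_integral_diff summable_periodic_times_exp)

lemma fourier_coeff_scale: "fourier_coeff (scale_L1 c f) k = c * fourier_coeff f k"
  by (transfer fixing: k) (simp add: mult.assoc)

lemma fourier_coeff_zero: "fourier_coeff 0 k = 0"
  using fourier_coeff_scale[of 0 0 k] by simp

lemma fourier_coeff_sum: "fourier_coeff (\<Sum>i\<in>I. f i) k = (\<Sum>i\<in>I. fourier_coeff (f i) k)"
  by (induction I rule: infinite_finite_induct) (auto simp: fourier_coeff_zero fourier_coeff_add)

lift_definition harmonic :: "int \<Rightarrow> per_L1" is "\<lambda>k x. exp (\<i> * of_int k * complex_of_real x)"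
proof -
  fix k
  have "exp (\<i> * of_int k * complex_of_real (x + 2 * pi))
      = exp (\<i> * of_int k * complex_of_real x)" for x
  proof -
    have "exp (\<i> * of_int k * complex_of_real (x + 2 * pi))
      = exp (\<i> * of_int k * complex_of_real x + of_int (2 * k) * (of_real pi * \<i>))"
      by (rule arg_cong[where f=exp]) (simp add: algebra_simps)
    then show ?thesis
      unfolding exp_add by (simp add: exp_eq_1)
  qed
  moreover have "set_integrable lebesgue {0..2 * pi} (\<lambda>x. exp (\<i> * of_int k * complex_of_real x))"
    by (intro absolutely_integrable_continuous_real continuous_intros)
  ultimately show "(\<lambda>x. exp (\<i> * of_int k * complex_of_real x)) \<in> summable_periodic \<and>
        (\<lambda>x. exp (\<i> * of_int k * complex_of_real x)) \<in> summable_periodic \<and>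
       (AE x in lebesgue. exp (\<i> * of_int k * complex_of_real x) = exp (\<i> * of_int k * complex_of_real x))"
    by (auto simp: summable_periodic_def)
qed


lemma fourier_coeff_harmonic: "fourier_coeff (harmonic m) k = (if k = m then 1 else 0)"
proof -
  have *: "exp (\<i> * of_int m * complex_of_real x) * exp (- (\<i> * of_int k * complex_of_real x))
      = exp (\<i> * of_int (m - k) * complex_of_real x)" for x
    unfolding exp_add[symmetric] by (rule arg_cong[where f=exp]) (simp add: algebra_simps)
  have int: "(LINT x:{0..2 * pi}|lebesgue. exp (\<i> * of_int j * complex_of_real x))
      = integral {0..2 * pi} (\<lambda>x. exp (\<i> * of_int j * complex_of_real x))" for j :: int
    by (intro set_lebesgue_integral_eq_integral absolutely_integrable_continuous_real
        continuous_intros)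
  have "integral {0..2 * pi} (\<lambda>x. exp (\<i> * of_int j * complex_of_real x)) = 0"
    if "j \<noteq> 0" for j :: int
  proof -
    have *: "((\<lambda>z. exp (c * z) / c) has_field_derivative exp (c * w)) (at w)"
      if "c \<noteq> 0" for c w :: complex
      using DERIV_cdivide[OF DERIV_chain2[OF DERIV_exp DERIV_cmult_Id], of c c w] that by simp
    have "((\<lambda>x. exp (\<i> * of_int j * complex_of_real x)) has_integral
        (exp (\<i> * of_int j * complex_of_real (2 * pi)) / (\<i> * of_int j)
         - exp (\<i> * of_int j * complex_of_real 0) / (\<i> * of_int j))) {0..2 * pi}"
    proof (rule fundamental_theorem_of_calculus)
      fix x :: real
      have "((\<lambda>z. exp (\<i> * of_int j * z) / (\<i> * of_int j)) has_field_derivative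
          exp (\<i> * of_int j * complex_of_real x)) (at (complex_of_real x))"
        using * [of "\<i> * of_int j"] that by simp
      then show "((\<lambda>x. exp (\<i> * of_int j * complex_of_real x) / (\<i> * of_int j))
          has_vector_derivative exp (\<i> * of_int j * complex_of_real x)) (at x within {0..2 * pi})"
        by (rule has_vector_derivative_real_field)
    qed simp
    moreover have "exp (\<i> * of_int j * complex_of_real (2 * pi)) = 1"
      unfolding exp_eq_1 by (auto simp: algebra_simps)
    ultimately show ?thesis
      by (simp add: integral_unique)
  qed
  moreover have "integral {0..2 * pi} (\<lambda>x. exp (\<i> * of_int 0 * complex_of_real x)) = 2 * pi"
    by (simp add: complex_eq_iff)
  ultimately have "integral {0..2 * pi} (\<lambda>x. exp (\<i> * of_int (m - k) * complex_of_real x))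
      = (if k = m then 2 * pi else 0)"
    by (cases "k = m") (simp_all del: of_int_diff)
  then show ?thesis
    by (transfer fixing: k m) (simp only: * int, simp)
qed

section \<open>Uniqueness of Fourier coefficients\<close>

text \<open>Trigonometric polynomials as functions on the line. The generators are the conjugate
  exponentials, the form in which they occur in the Fourier integral; an inductive closure makes
  stability under products, and any linear functional, accessible by rule induction.\<close>

inductive trig_poly :: "(real \<Rightarrow> complex) \<Rightarrow> bool" where
  expo: "trig_poly (\<lambda>x. exp (- (\<i> * of_int k * complex_of_real x)))"
| plus: "trig_poly p \<Longrightarrow> trig_poly q \<Longrightarrow> trig_poly (\<lambda>x. p x + q x)"
| scale: "trig_poly p \<Longrightarrow> trig_poly (\<lambda>x. c * p x)"

lemma trig_poly_const: "trig_poly (\<lambda>x. c)"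
  using trig_poly.scale[OF trig_poly.expo[of 0], of c] by simp

lemma trig_poly_mult:
  assumes "trig_poly p" "trig_poly q"
  shows "trig_poly (\<lambda>x. p x * q x)"
  using assms
proof (induction rule: trig_poly.induct)
  case (expo k)
  then show ?case
  proof (induction rule: trig_poly.induct)
    case (expo l)
    have "exp (- (\<i> * of_int k * complex_of_real x)) * exp (- (\<i> * of_int l * complex_of_real x))
        = exp (- (\<i> * of_int (k + l) * complex_of_real x))" for x
      unfolding exp_add[symmetric] by (rule arg_cong[where f=exp]) (simp add: algebra_simps)
    then show ?case by (simp only: trig_poly.expo)
  next
    case (plus p q)
    then show ?case by (simp add: distrib_left trig_poly.plus)
  next
    case (scale p c)
    then show ?case using trig_poly.scale[OF scale.IH, of c] by (simp only: mult.left_commute)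
  qed
next
  case (plus p q)
  then show ?case by (simp add: distrib_right trig_poly.plus)
next
  case (scale p c)
  then show ?case using trig_poly.scale[OF scale.IH[OF scale.prems], of c] by (simp only: mult.assoc)
qed

lemma trig_poly_Re_cis: "trig_poly (\<lambda>x. of_real (Re (cis x)))"
  and trig_poly_Im_cis: "trig_poly (\<lambda>x. of_real (Im (cis x)))"
proof -
  have e: "exp (- (\<i> * of_int (-1) * complex_of_real x)) = cis x"
    "exp (- (\<i> * of_int 1 * complex_of_real x)) = cnj (cis x)" for x
    by (simp_all add: cis_conv_exp exp_cnj)
  have *: "of_real (Re (cis x)) = (1/2) * exp (- (\<i> * of_int (-1) * complex_of_real x))
      + (1/2) * exp (- (\<i> * of_int 1 * complex_of_real x))"
     "of_real (Im (cis x)) = (- \<i>/2) * exp (- (\<i> * of_int (-1) * complex_of_real x))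
      + (\<i>/2) * exp (- (\<i> * of_int 1 * complex_of_real x))" for x
    unfolding e by (auto simp: complex_eq_iff)
  show "trig_poly (\<lambda>x. of_real (Re (cis x)))" "trig_poly (\<lambda>x. of_real (Im (cis x)))"
    unfolding * by (rule trig_poly.plus trig_poly.scale trig_poly.expo)+
qed

text \<open>Restricted to the unit circle, a polynomial in the two real coordinates is a
  trigonometric polynomial, because cosine and sine are. This turns the Weierstrass theorem in
  the plane into a statement about trigonometric approximation.\<close>

lemma trig_poly_real_polynomial_cis:
  assumes "real_polynomial_function p"
  shows "trig_poly (\<lambda>x. of_real (p (cis x)))"
  using assms
proof (induction rule: real_polynomial_function.induct)
  case (linear p)
  interpret bounded_linear p by fact
  have "p z = Re z * p 1 + Im z * p \<i>" for z
  proof -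
    have "p z = p (Re z *\<^sub>R 1 + Im z *\<^sub>R \<i>)" by (rule arg_cong[where f=p]) (simp add: complex_eq_iff)
    then show ?thesis by (simp only: add scaleR real_scaleR_def)
  qed
  then have "of_real (p (cis x)) = of_real (p 1) * of_real (Re (cis x))
       + complex_of_real (p \<i>) * of_real (Im (cis x))" for x
    by (metis mult.commute of_real_add of_real_mult)
  then show ?case
    using trig_poly.plus[OF trig_poly.scale[OF trig_poly_Re_cis] trig_poly.scale[OF trig_poly_Im_cis]]
    by simp
next
  case (const c)
  then show ?case by (rule trig_poly_const)
next
  case (add f g)
  then show ?case by (simp add: trig_poly.plus)
next
  case (mult f g)
  then show ?case by (simp add: trig_poly_mult)
qed

text \<open>A continuous function with equal values at both ends of the period lives on the unit circle,
  which is compact, so the Stone--Weierstrass theorem in the plane applies there.\<close>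

lemma trig_poly_dense:
  fixes g :: "real \<Rightarrow> complex"
  assumes g: "continuous_on {0..2 * pi} g" "g 0 = g (2 * pi)" and "0 < e"
  obtains p where "trig_poly p" "\<And>x. x \<in> {0..2 * pi} \<Longrightarrow> cmod (g x - p x) < e"
proof -
  define G where "G z = g (Arg2pi z)" for z
  have cis: "G (cis x) = g x" if "x \<in> {0..2 * pi}" for x
  proof (cases "x = 2 * pi")
    case True
    have "Arg2pi (cis (2 * pi)) = 0"
      by (rule Arg2pi_unique[of 1]) auto
    then show ?thesis using True g by (simp add: G_def)
  next
    case False
    then have "Arg2pi (cis x) = x"
      using that by (intro Arg2pi_unique[of 1]) (auto simp: cis_conv_exp)
    then show ?thesis by (simp add: G_def)
  qed
  \<comment> \<open>\<open>cis\<close> maps the compact interval onto the circle, hence closed sets to closed sets\<close>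
  have "continuous_on (sphere 0 1) G"
    unfolding continuous_on_closed_vimage[OF closed_sphere]
  proof (intro allI impI)
    fix C :: "complex set"
    assume "closed C"
    then have "closed ({0..2 * pi} \<inter> g -` C)"
      using g(1) continuous_on_closed_vimage[of "{0..2 * pi}" g] by (simp add: Int_commute)
    then have "compact ({0..2 * pi} \<inter> g -` C)"
      using bounded_subset[OF bounded_closed_interval[of 0 "2 * pi"]] by (simp add: compact_eq_bounded_closed)
    then have "compact (cis ` ({0..2 * pi} \<inter> g -` C))"
      by (intro compact_continuous_image continuous_intros)
    moreover have "cis ` ({0..2 * pi} \<inter> g -` C) = G -` C \<inter> sphere 0 1"
    proof (intro set_eqI iffI)
      fix z assume z: "z \<in> G -` C \<inter> sphere 0 1"
      have "z = cis (Arg2pi z)"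
        using z complex_norm_eq_1_exp[of z] by (simp add: cis_conv_exp)
      then show "z \<in> cis ` ({0..2 * pi} \<inter> g -` C)"
        using z Arg2pi_ge_0[of z] Arg2pi_lt_2pi[of z] by (auto simp: G_def)
    qed (auto simp: cis)
    ultimately show "closed (G -` C \<inter> sphere 0 1)"
      by (simp add: compact_imp_closed)
  qed
  then obtain P where P: "polynomial_function P" "\<And>z. z \<in> sphere 0 1 \<Longrightarrow> cmod (G z - P z) < e"
    using Stone_Weierstrass_polynomial_function[of "sphere 0 1" G e] \<open>0 < e\<close> by auto
  have "trig_poly (\<lambda>x. of_real ((Re \<circ> P) (cis x)) + \<i> * of_real ((Im \<circ> P) (cis x)))"
    using P(1) unfolding polynomial_function_def
    by (intro trig_poly.plus trig_poly.scale trig_poly_real_polynomial_cis)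
      (use bounded_linear_Re bounded_linear_Im in blast)+
  moreover have "of_real ((Re \<circ> P) (cis x)) + \<i> * of_real ((Im \<circ> P) (cis x)) = P (cis x)" for x
    by (simp add: complex_eq_iff)
  ultimately have "trig_poly (\<lambda>x. P (cis x))" by simp
  moreover have "cmod (g x - P (cis x)) < e" if "x \<in> {0..2 * pi}" for x
    using P(2)[of "cis x"] cis[OF that] by simp
  ultimately show ?thesis by (rule that)
qed

lemma integral_vanishes_periodic_continuous:
  fixes f g :: "real \<Rightarrow> complex"
  assumes f: "set_integrable lebesgue {0..2 * pi} f"
    and ortho: "\<And>k. (LINT x:{0..2 * pi}|lebesgue. f x * exp (- (\<i> * of_int k * complex_of_real x))) = 0"
    and g: "continuous_on {0..2 * pi} g" "g 0 = g (2 * pi)" "set_integrable lebesgue {0..2 * pi} (\<lambda>x. f x * g x)"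
  shows "(LINT x:{0..2 * pi}|lebesgue. f x * g x) = 0"
proof -
  have trig: "set_integrable lebesgue {0..2 * pi} (\<lambda>x. f x * p x) \<and>
      (LINT x:{0..2 * pi}|lebesgue. f x * p x) = 0" if "trig_poly p" for p
    using that
  proof (induction rule: trig_poly.induct)
    case (expo k)
    have "set_integrable lebesgue {0..2 * pi} (\<lambda>x. f x * exp (- (\<i> * of_int k * complex_of_real x)))"
      by (intro integrable_times_bounded f continuous_imp_lebesgue_measurable continuous_intros) simp
    then show ?case using ortho by blast
  next
    case (plus p q)
    then show ?case by (simp add: distrib_left set_integral_add)
  next
    case (scale p c)
    then show ?case by (simp add: mult.left_commute[of _ c])
  qed
  define C where "C = (LINT x:{0..2 * pi}|lebesgue. cmod (f x))"
  have fn: "set_integrable lebesgue {0..2 * pi} (\<lambda>x. cmod (f x))"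
    using f by (rule set_integrable_norm)
  have bound: "cmod (LINT x:{0..2 * pi}|lebesgue. f x * g x) \<le> e * C" if "e > 0" for e
  proof -
    obtain p where p: "trig_poly p" "\<And>x. x \<in> {0..2 * pi} \<Longrightarrow> cmod (g x - p x) < e"
      using trig_poly_dense[OF g(1,2) \<open>e > 0\<close>] by blast
    note pi = trig[OF p(1), THEN conjunct1]
    have d: "set_integrable lebesgue {0..2 * pi} (\<lambda>x. f x * (g x - p x))"
      using set_integral_diff(1)[OF g(3) pi] by (simp add: right_diff_distrib)
    have "(LINT x:{0..2 * pi}|lebesgue. f x * g x)
        = (LINT x:{0..2 * pi}|lebesgue. f x * (g x - p x))"
      using set_integral_diff(2)[OF g(3) pi] trig[OF p(1)] by (simp add: right_diff_distrib)
    also have "cmod \<dots> \<le> (LINT x:{0..2 * pi}|lebesgue. cmod (f x * (g x - p x)))"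
      using d by (rule set_integral_norm_bound)
    also have "\<dots> \<le> (LINT x:{0..2 * pi}|lebesgue. e * cmod (f x))"
    proof (rule set_integral_mono)
      show "cmod (f x * (g x - p x)) \<le> e * cmod (f x)" if "x \<in> {0..2 * pi}" for x
        using mult_left_mono[OF less_imp_le[OF p(2)[OF that]], of "cmod (f x)"]
        by (simp add: norm_mult mult.commute)
    qed (use set_integrable_norm[OF d] fn in auto)
    also have "\<dots> = e * C" by (simp add: C_def)
    finally show ?thesis .
  qed
  have "C \<ge> 0" unfolding C_def set_lebesgue_integral_def by (rule Bochner_Integration.integral_nonneg) simp
  have "cmod (LINT x:{0..2 * pi}|lebesgue. f x * g x) \<le> 0 + e" if "e > 0" for e
  proof -
    have "cmod (LINT x:{0..2 * pi}|lebesgue. f x * g x) \<le> e / (C + 1) * C"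
      using that \<open>C \<ge> 0\<close> by (intro bound) auto
    also have "\<dots> \<le> e" using that \<open>C \<ge> 0\<close> by (simp add: field_simps)
    finally show ?thesis by simp
  qed
  then have "cmod (LINT x:{0..2 * pi}|lebesgue. f x * g x) \<le> 0"
    by (rule field_le_epsilon)
  then show ?thesis by simp
qed

text \<open>The reason is that orthogonality to all exponentials extends to all continuous periodic
  functions, and these approximate the conjugate sign of \<open>f\<close> almost everywhere while staying
  bounded by one. Dominated convergence then gives \<open>\<integral> \<bar>f\<bar> = 0\<close>.\<close>

lemma AE_zero_of_orthogonal_exp:
  fixes f :: "real \<Rightarrow> complex"
  assumes f: "set_integrable lebesgue {0..2 * pi} f"
    and ortho: "\<And>k. (LINT x:{0..2 * pi}|lebesgue. f x * exp (- (\<i> * of_int k * complex_of_real x))) = 0"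
  shows "AE x in lebesgue. x \<in> {0..2 * pi} \<longrightarrow> f x = 0"
proof -
  define F where "F x = indicat_real {0..2 * pi} x *\<^sub>R f x" for x
  have F: "integrable lebesgue F" using f by (simp add: F_def[abs_def] set_integrable_def)
  define h where "h x = cnj (sgn (F x))" for x
  have hm: "h \<in> borel_measurable lebesgue"
  proof -
    have "(\<lambda>x. F x /\<^sub>R cmod (F x)) \<in> borel_measurable lebesgue"
      using F by auto
    then have "(\<lambda>x. cnj (F x /\<^sub>R cmod (F x))) \<in> borel_measurable lebesgue"
      by (rule borel_measurable_continuous_on[OF continuous_on_cnj[OF continuous_on_id]])
    then show ?thesis by (simp add: h_def[abs_def] sgn_div_norm)
  qed
  obtain Z G where Z: "negligible Z" and G: "\<And>n. continuous_on UNIV (G n)"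
    and lim: "\<And>x. x \<notin> Z \<Longrightarrow> (\<lambda>n. G n x) \<longlonglongrightarrow> h x"
    using lebesgue_measurable_imp_measurable_on[OF hm, of UNIV] unfolding measurable_on_def by auto
  \<comment> \<open>The approximants are cut down to the unit disc and made to vanish at both end points.\<close>
  define cut where "cut n x = min 1 (real n * max 0 (x * (2 * pi - x)))" for n x
  define K where "K n x = of_real (cut n x) * (G n x / of_real (max 1 (cmod (G n x))))" for n x
  have cut01: "0 \<le> cut n x" "cut n x \<le> 1" for n x by (auto simp: cut_def)
  have K1: "cmod (K n x) \<le> 1" for n x
  proof -
    have "cmod (G n x) / max 1 (cmod (G n x)) \<le> 1" by (simp add: divide_le_eq_1 less_max_iff_disj)
    then have "cut n x * (cmod (G n x) / max 1 (cmod (G n x))) \<le> 1"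
      using cut01[of n x] by (intro mult_le_one) auto
    then show ?thesis using cut01[of n x] by (simp add: K_def norm_mult norm_divide)
  qed
  have Kc: "continuous_on UNIV (K n)" for n
    unfolding K_def cut_def by (intro continuous_intros G) (auto simp: max_def)
  have Km: "K n \<in> borel_measurable lebesgue" for n
    by (rule continuous_imp_lebesgue_measurable[OF Kc])
  have zero: "(LINT x:{0..2 * pi}|lebesgue. f x * K n x) = 0" for n
  proof (rule integral_vanishes_periodic_continuous[OF f ortho])
    show "continuous_on {0..2 * pi} (K n)" using Kc continuous_on_subset by blast
    show "K n 0 = K n (2 * pi)" by (simp add: K_def cut_def)
    show "set_integrable lebesgue {0..2 * pi} (\<lambda>x. f x * K n x)"
      by (intro integrable_times_bounded f Km K1)
  qed
  have F01: "F x = 0" if "\<not> (0 < x \<and> x < 2 * pi)" "x \<notin> {0, 2 * pi}" for x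
    using that by (auto simp: F_def indicator_def)
  have "(\<lambda>n. LINT x|lebesgue. F x * K n x) \<longlonglongrightarrow> (LINT x|lebesgue. of_real (cmod (F x)))"
  proof (rule integral_dominated_convergence)
    show "integrable lebesgue (\<lambda>x. cmod (F x))" using F by simp
    show "(\<lambda>x. complex_of_real (cmod (F x))) \<in> borel_measurable lebesgue" using F by simp
    show "(\<lambda>x. F x * K n x) \<in> borel_measurable lebesgue" for n using F Km by auto
    show "AE x in lebesgue. cmod (F x * K n x) \<le> cmod (F x)" for n
      using K1 by (auto simp: norm_mult mult_left_le)
    have "AE x in lebesgue. x \<notin> Z \<union> {0, 2 * pi}"
      using Z by (intro AE_not_in) (auto simp: negligible_iff_null_sets[symmetric])
    then show "AE x in lebesgue. (\<lambda>n. F x * K n x) \<longlonglongrightarrow> of_real (cmod (F x))"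
    proof eventually_elim
      case (elim x)
      show ?case
      proof (cases "0 < x \<and> x < 2 * pi")
        case False
        then show ?thesis using F01[OF False] elim by simp
      next
        case True
        then have pos: "0 < x * (2 * pi - x)" by simp
        have "(\<lambda>n. cut n x) \<longlonglongrightarrow> 1"
        proof (rule tendsto_eventually)
          obtain m :: nat where "1 / (x * (2 * pi - x)) < real m" using reals_Archimedean2 by blast
          then have "1 \<le> real n * (x * (2 * pi - x))" if "n \<ge> m" for n
          proof -
            have "1 / (x * (2 * pi - x)) \<le> real n" using that \<open>1 / (x * (2 * pi - x)) < real m\<close> by simp
            then show ?thesis using pos by (simp add: pos_divide_le_eq)
          qed
          then show "\<forall>\<^sub>F n in sequentially. cut n x = 1"
            unfolding cut_def using pos by (intro eventually_sequentiallyI[of m]) (auto simp: min_def)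
        qed
        moreover have "cmod (h x) \<le> 1" by (simp add: h_def norm_sgn)
        moreover have "(\<lambda>n. G n x / of_real (max 1 (cmod (G n x)))) \<longlonglongrightarrow> h x / of_real (max 1 (cmod (h x)))"
          using elim by (intro tendsto_intros lim) (auto simp: max_def)
        ultimately have "(\<lambda>n. F x * K n x) \<longlonglongrightarrow> F x * (of_real 1 * (h x / of_real 1))"
          unfolding K_def by (intro tendsto_mult tendsto_const tendsto_of_real) (simp_all add: max_def split: if_splits)
        moreover have "F x * h x = of_real (cmod (F x))"
        proof (cases "F x = 0")
          case False
          have "F x * h x = (F x * cnj (F x)) / of_real (cmod (F x))"
            by (simp add: h_def sgn_div_norm scaleR_conv_of_real field_simps)
          also have "\<dots> = of_real (cmod (F x))"
            using False by (simp add: complex_norm_square[symmetric] power2_eq_square)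
          finally show ?thesis .
        qed simp
        ultimately show ?thesis by simp
      qed
    qed
  qed
  moreover have "(LINT x|lebesgue. F x * K n x) = 0" for n
    using zero[of n] by (simp add: set_lebesgue_integral_def F_def)
  ultimately have "(LINT x|lebesgue. complex_of_real (cmod (F x))) = 0"
    using LIMSEQ_unique[OF _ tendsto_const] by force
  then have "(LINT x|lebesgue. cmod (F x)) = 0" by simp
  then have "AE x in lebesgue. cmod (F x) = 0"
    using F by (subst (asm) integral_nonneg_eq_0_iff_AE) auto
  then show ?thesis by eventually_elim (auto simp: F_def)
qed

text \<open>Uniqueness of Fourier coefficients. Without it a subspace could contain a nonzero element of
  Orlicz norm zero, and the upper bound for the Bernstein width would fail.\<close>

lemma fourier_coeff_eq_zero_imp:
  assumes "\<And>k. fourier_coeff f k = 0"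
  shows "f = 0"
  using assms
proof transfer
  fix f :: "real \<Rightarrow> complex"
  assume *: "f \<in> summable_periodic \<and> f \<in> summable_periodic \<and> (AE x in lebesgue. f x = f x)"
    and "\<And>k. complex_of_real (1 / (2 * pi)) *
      (LINT x:{0..2 * pi}|lebesgue. f x * exp (- (\<i> * of_int k * complex_of_real x))) = 0"
  then have "AE x in lebesgue. x \<in> {0..2 * pi} \<longrightarrow> f x = 0"
    by (intro AE_zero_of_orthogonal_exp) (auto simp: summable_periodic_def)
  then obtain N where "N \<in> null_sets lebesgue" "{x. \<not> (x \<in> {0..2 * pi} \<longrightarrow> f x = 0)} \<subseteq> N"
    unfolding eventually_ae_filter by auto
  then have "negligible N" "{x \<in> {0..2 * pi}. f x \<noteq> 0} \<subseteq> N"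
    unfolding negligible_iff_null_sets by blast+
  then have Z: "negligible {x \<in> {0..2 * pi}. f x \<noteq> 0}" (is "negligible ?Z")
    by (rule negligible_subset)
  have per: "f (x + 2 * pi * of_int k) = f x" for x k
  proof -
    have nat: "f (x + 2 * pi * real n) = f x" for x n
    proof (induction n)
      case (Suc n)
      have "f (x + 2 * pi * real (Suc n)) = f ((x + 2 * pi * real n) + 2 * pi)"
        by (rule arg_cong[where f=f]) (simp add: algebra_simps)
      also have "\<dots> = f x" using * Suc by (simp add: summable_periodic_def)
      finally show ?case .
    qed simp
    show ?thesis
    proof (cases k)
      case (nonneg n) then show ?thesis using nat by simp
    next
      case (neg n)
      then have "x + 2 * pi * of_int k + 2 * pi * real (Suc n) = x"
        by (simp, simp add: algebra_simps)
      then show ?thesis using nat[of "x + 2 * pi * of_int k" "Suc n"] by metis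
    qed
  qed
  have "negligible (\<Union>k::int. (\<lambda>x. 2 * pi * of_int k + x) ` ?Z)"
    by (intro negligible_countable_Union) (use negligible_translation[OF Z] in blast)+
  moreover have "{x. f x \<noteq> 0} \<subseteq> (\<Union>k::int. (\<lambda>x. 2 * pi * of_int k + x) ` ?Z)"
  proof
    fix x assume x: "x \<in> {x. f x \<noteq> 0}"
    define k where "k = \<lfloor>x / (2 * pi)\<rfloor>"
    have "of_int k \<le> x / (2 * pi)" "x / (2 * pi) < of_int k + 1" by (auto simp: k_def)
    then have "2 * pi * of_int k \<le> x" "x < 2 * pi * of_int k + 2 * pi"
      by (simp_all add: field_simps)
    moreover have "f (x - 2 * pi * of_int k) = f x"
      using per[of x "- k"] by simp
    ultimately show "x \<in> (\<Union>k::int. (\<lambda>x. 2 * pi * of_int k + x) ` ?Z)"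
      using x by (intro UN_I[of k] image_eqI[of _ _ "x - 2 * pi * of_int k"]) auto
  qed
  ultimately have "{x. f x \<noteq> 0} \<in> null_sets lebesgue"
    using negligible_subset negligible_iff_null_sets by blast
  then show "f \<in> summable_periodic \<and> (\<lambda>x. 0) \<in> summable_periodic \<and> (AE x in lebesgue. f x = 0)"
    using * by (auto simp: summable_periodic_def set_integrable_def dest!: AE_not_in)
qed

section \<open>Stieltjes integrals\<close>

lemma right_cont_ext_mono:
  assumes "a \<le> b" and g: "mono_on {a..b} g" and "x \<le> y"
  shows "right_cont_ext g a b x \<le> right_cont_ext g a b y"
proof -
  have bdd: "bdd_below (g ` {z<..b})" if "a \<le> z" for z
    using that g by (intro bdd_belowI2[where m="g a"]) (auto simp: mono_on_def)
  have lower: "g a \<le> (INF t\<in>{z<..b}. g t)" if "a \<le> z" "z < b" for z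
    using that g by (intro cINF_greatest) (auto simp: mono_on_def)
  have upper: "(INF t\<in>{z<..b}. g t) \<le> g b" if "a \<le> z" "z < b" for z
    using that bdd by (intro cINF_lower) auto
  have anti: "(INF t\<in>{x<..b}. g t) \<le> (INF t\<in>{y<..b}. g t)" if "a \<le> x" "y < b"
    using that \<open>x \<le> y\<close> bdd by (intro cINF_superset_mono) auto
  have "g a \<le> g b" using g \<open>a \<le> b\<close> by (auto simp: mono_on_def)
  then show ?thesis
    using lower[of y] upper[of x] anti \<open>x \<le> y\<close> by (auto simp: right_cont_ext_def)
qed

lemma right_cont_ext_right_continuous:
  assumes "a \<le> b" and g: "mono_on {a..b} g"
  shows "continuous (at_right x) (right_cont_ext g a b)"
proof -
  let ?R = "right_cont_ext g a b"
  have const: "continuous (at_right x) ?R" if "x < d" "\<And>y. x < y \<Longrightarrow> y < d \<Longrightarrow> ?R y = ?R x" for d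
  proof -
    have "\<forall>\<^sub>F y in at_right x. ?R y = ?R x"
      unfolding eventually_at_right[OF \<open>x < d\<close>] using that by blast
    then show ?thesis by (simp add: continuous_within tendsto_eventually)
  qed
  consider "x < a" | "b \<le> x" | "a \<le> x" "x < b" by linarith
  then show ?thesis
  proof cases
    case 1
    then show ?thesis by (intro const[of a]) (auto simp: right_cont_ext_def)
  next
    case 2
    then show ?thesis using \<open>a \<le> b\<close> by (intro const[of "x + 1"]) (auto simp: right_cont_ext_def)
  next
    case 3
    have bdd: "bdd_below (g ` {z<..b})" if "a \<le> z" for z
      using that g by (intro bdd_belowI2[where m="g a"]) (auto simp: mono_on_def)
    show ?thesis
      unfolding continuous_within
    proof (rule order_tendstoI)
      fix c assume "c < ?R x"
      then have "c < ?R y" if "x < y" for y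
        using right_cont_ext_mono[OF assms, of x y] that by linarith
      then show "\<forall>\<^sub>F y in at_right x. c < ?R y"
        by (auto simp: eventually_at_right[of x "x + 1"] intro!: exI[of _ "x + 1"])
    next
      fix c assume "?R x < c"
      then have "(INF t\<in>{x<..b}. g t) < c" using 3 by (simp add: right_cont_ext_def)
      then obtain t where t: "x < t" "t \<le> b" "g t < c"
        using 3 bdd by (subst (asm) cINF_less_iff) auto
      have "?R y < c" if "x < y" "y < t" for y
      proof -
        have "?R y \<le> g t" using that t 3 bdd by (auto simp: right_cont_ext_def intro!: cINF_lower)
        then show ?thesis using t by simp
      qed
      then show "\<forall>\<^sub>F y in at_right x. ?R y < c"
        using t unfolding eventually_at_right[OF t(1)] by blast
    qed
  qed
qed

text \<open>The uniform bound makes the measures finite, so that they are determined by the half-lines,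
  which are increasing unions of the half-open intervals.\<close>

lemma measure_eqI_Ioc:
  fixes M N :: "real measure"
  assumes sets: "sets M = sets borel" "sets N = sets borel"
    and bound: "\<And>x y. x \<le> y \<Longrightarrow> emeasure M {x<..y} \<le> ennreal C"
    and eq: "\<And>x y. x \<le> y \<Longrightarrow> emeasure M {x<..y} = emeasure N {x<..y}"
  shows "M = N"
proof (rule measure_eqI_lessThan)
  have un: "{x<..} = (\<Union>n. {x<..x + real n})" for x :: real
  proof (intro set_eqI iffI)
    fix y assume "y \<in> {x<..}"
    moreover obtain n where "y - x < real n" using reals_Archimedean2 by blast
    ultimately show "y \<in> (\<Union>n. {x<..x + real n})" by (intro UN_I[of n]) auto
  qed auto
  have lim: "emeasure L {x<..} = (SUP n. emeasure L {x<..x + real n})" if "sets L = sets borel" for L and x :: real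
  proof -
    have "range (\<lambda>n. {x<..x + real n}) \<subseteq> sets L" unfolding that by auto
    moreover have "incseq (\<lambda>n. {x<..x + real n})" by (auto simp: incseq_def intro: order_trans)
    ultimately show ?thesis
      using SUP_emeasure_incseq[of "\<lambda>n. {x<..x + real n}" L] by (simp only: un)
  qed
  show "emeasure M {x<..} = emeasure N {x<..}" for x
    by (simp add: lim sets eq)
  have "emeasure M {x<..} \<le> ennreal C" for x
    unfolding lim[OF sets(1)] by (intro SUP_least bound) simp
  then show "emeasure M {x<..} < \<infinity>" for x
    using le_less_trans[OF _ ennreal_less_top] by auto
qed (use sets in auto)

lemma right_cont_ext_scale:
  assumes "0 < c"
  shows "right_cont_ext (\<lambda>t. g (t / c)) (c * a) (c * b) x = right_cont_ext g a b (x / c)"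
proof -
  have im: "(\<lambda>t. t / c) ` {x<..c * b} = {x / c<..b}"
  proof (intro set_eqI iffI)
    fix y assume "y \<in> {x / c<..b}"
    then show "y \<in> (\<lambda>t. t / c) ` {x<..c * b}"
      using assms by (intro image_eqI[of _ _ "c * y"]) (auto simp: field_simps)
  qed (use assms in \<open>auto simp: field_simps\<close>)
  have "(INF y\<in>{x<..c * b}. g (y / c)) = (INF y\<in>{x / c<..b}. g y)"
    unfolding im[symmetric] by (simp add: image_image)
  then show ?thesis using assms by (auto simp: right_cont_ext_def field_simps)
qed

text \<open>Substitution \<open>t \<mapsto> c t\<close>. Both Stieltjes measures are determined by the increments of their
  distribution functions, and the distribution function of the left-hand side is a rescaling of
  that on the right.\<close>

lemma stieltjes_integral_scale:
  assumes "0 < c" "a \<le> b" and g: "mono_on {a..b} g" and f: "f \<in> borel_measurable borel"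
  shows "stieltjes_integral (c * a) (c * b) f (\<lambda>t. g (t / c)) = stieltjes_integral a b (\<lambda>t. f (c * t)) g"
proof -
  let ?R = "right_cont_ext g a b" and ?R' = "right_cont_ext (\<lambda>t. g (t / c)) (c * a) (c * b)"
  have g': "mono_on {c * a..c * b} (\<lambda>t. g (t / c))"
    using g \<open>0 < c\<close> unfolding mono_on_def by (auto simp: field_simps divide_right_mono)
  have ab': "c * a \<le> c * b" using assms by simp
  have e: "emeasure (interval_measure ?R) {x<..y} = ennreal (?R y - ?R x)" if "x \<le> y" for x y
    by (rule emeasure_interval_measure_Ioc[OF that])
      (auto intro: right_cont_ext_mono right_cont_ext_right_continuous assms)
  have e': "emeasure (interval_measure ?R') {x<..y} = ennreal (?R' y - ?R' x)" if "x \<le> y" for x y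
    by (rule emeasure_interval_measure_Ioc[OF that])
      (rule right_cont_ext_mono[OF ab' g'] right_cont_ext_right_continuous[OF ab' g'] | assumption)+
  have distr: "interval_measure ?R' = distr (interval_measure ?R) borel (\<lambda>t. c * t)"
  proof (rule measure_eqI_Ioc)
    fix x y :: real assume "x \<le> y"
    have "?R x \<ge> ?R (min x (a - 1))" "?R y \<le> ?R (max y b)" for x y
      using assms by (auto intro: right_cont_ext_mono)
    moreover have "?R (min x (a - 1)) = g a" "?R (max y b) = g b" for x y
      using \<open>a \<le> b\<close> by (auto simp: right_cont_ext_def min_less_iff_disj)
    ultimately have "?R x \<ge> g a" "?R y \<le> g b" for x y by metis+
    then have "?R (y / c) - ?R (x / c) \<le> g b - g a" by (simp add: diff_mono)
    then show "emeasure (interval_measure ?R') {x<..y} \<le> ennreal (g b - g a)"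
      using e'[OF \<open>x \<le> y\<close>] \<open>0 < c\<close> by (simp add: right_cont_ext_scale ennreal_leI)
    have "(\<lambda>t. c * t) -` {x<..y} = {x / c<..y / c}" using \<open>0 < c\<close> by (auto simp: field_simps)
    then show "emeasure (interval_measure ?R') {x<..y}
        = emeasure (distr (interval_measure ?R) borel (\<lambda>t. c * t)) {x<..y}"
      using e'[OF \<open>x \<le> y\<close>] \<open>0 < c\<close> \<open>x \<le> y\<close>
      by (simp add: emeasure_distr e right_cont_ext_scale divide_right_mono)
  qed simp_all
  have "stieltjes_integral (c * a) (c * b) f (\<lambda>t. g (t / c))
      = (\<integral>\<^sup>+t. f (c * t) * indicator {c * a..c * b} (c * t) \<partial>interval_measure ?R)"
    unfolding stieltjes_integral_def distr using f by (subst nn_integral_distr) auto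
  also have "\<dots> = stieltjes_integral a b (\<lambda>t. f (c * t)) g"
    unfolding stieltjes_integral_def using \<open>0 < c\<close>
    by (intro nn_integral_cong) (auto simp: indicator_def)
  finally show ?thesis .
qed

lemma stieltjes_integral_mono:
  assumes "\<And>t. t \<in> {a..b} \<Longrightarrow> f t \<le> h t"
  shows "stieltjes_integral a b f g \<le> stieltjes_integral a b h g"
  unfolding stieltjes_integral_def
  by (intro nn_integral_mono) (auto simp: indicator_def assms)

lemma stieltjes_integral_cmult:
  assumes "f \<in> borel_measurable borel"
  shows "stieltjes_integral a b (\<lambda>t. c * f t) g = c * stieltjes_integral a b f g"
  unfolding stieltjes_integral_def mult.assoc using assms by (intro nn_integral_cmult) auto

lemma stieltjes_integral_sum:
  assumes "\<And>i. i \<in> I \<Longrightarrow> f i \<in> borel_measurable borel"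
  shows "stieltjes_integral a b (\<lambda>t. \<Sum>i\<in>I. f i t) g = (\<Sum>i\<in>I. stieltjes_integral a b (f i) g)"
  unfolding stieltjes_integral_def sum_distrib_right using assms by (intro nn_integral_sum) auto

section \<open>The Orlicz norm\<close>

lemma infsum_ennreal_le_iff:
  fixes f :: "'a \<Rightarrow> ennreal"
  shows "(\<Sum>\<^sub>\<infinity>k. f k) \<le> B \<longleftrightarrow> (\<forall>F. finite F \<longrightarrow> sum f F \<le> B)"
  by (subst nonneg_infsum_complete) (auto simp: SUP_le_iff)

text \<open>A bound for the norm is a bound for all finite partial sums, and these commute with
  integration for free.\<close>

lemma orlicz_norm_seq_le_iff:
  "orlicz_norm_seq M c \<le> B \<longleftrightarrow>
    (\<forall>l\<in>dual_sequences M. \<forall>F. finite F \<longrightarrow> (\<Sum>k\<in>F. ennreal (l k * cmod (c k))) \<le> B)"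
  by (simp add: orlicz_norm_seq_def SUP_le_iff infsum_ennreal_le_iff)

lemma sum_le_orlicz_norm_seq:
  assumes "l \<in> dual_sequences M" "finite F"
  shows "(\<Sum>k\<in>F. ennreal (l k * cmod (c k))) \<le> orlicz_norm_seq M c"
  using assms orlicz_norm_seq_le_iff[of M c "orlicz_norm_seq M c"] by blast

lemma dual_sequence_pos: "l \<in> dual_sequences M \<Longrightarrow> 0 < l k"
  by (simp add: dual_sequences_def)

text \<open>The norm depends monotonically on the moduli of the entries. In particular every coordinate
  truncation is a contraction, which is what singles out the Fourier partial sums below.\<close>

lemma orlicz_norm_seq_le_cmult:
  assumes "0 \<le> C" and "\<And>k. cmod (c k) \<le> C * cmod (d k)"
  shows "orlicz_norm_seq M c \<le> ennreal C * orlicz_norm_seq M d"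
  unfolding orlicz_norm_seq_le_iff
proof (intro ballI allI impI)
  fix l and F :: "int set"
  assume l: "l \<in> dual_sequences M" and F: "finite F"
  have "(\<Sum>k\<in>F. ennreal (l k * cmod (c k))) \<le> (\<Sum>k\<in>F. ennreal C * ennreal (l k * cmod (d k)))"
  proof (rule sum_mono)
    fix k
    have "l k * cmod (c k) \<le> C * (l k * cmod (d k))"
      using mult_left_mono[OF assms(2)[of k], of "l k"] dual_sequence_pos[OF l, of k]
      by (simp add: mult_ac)
    then show "ennreal (l k * cmod (c k)) \<le> ennreal C * ennreal (l k * cmod (d k))"
      using assms(1) by (simp add: ennreal_mult'[symmetric] ennreal_leI)
  qed
  also have "\<dots> \<le> ennreal C * orlicz_norm_seq M d"
    unfolding sum_distrib_left[symmetric] by (intro mult_left_mono sum_le_orlicz_norm_seq l F) simp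
  finally show "(\<Sum>k\<in>F. ennreal (l k * cmod (c k))) \<le> ennreal C * orlicz_norm_seq M d" .
qed

lemma orlicz_norm_seq_mono:
  assumes "\<And>k. cmod (c k) \<le> cmod (d k)"
  shows "orlicz_norm_seq M c \<le> orlicz_norm_seq M d"
  using orlicz_norm_seq_le_cmult[of 1 c d M] assms by simp

lemma young_le_conjugate:
  assumes "0 \<le> u" shows "ennreal (v * u) \<le> ennreal (M u) + conjugate M v"
proof -
  have "ennreal (x + y) \<le> ennreal x + ennreal y" for x y
    by (cases "0 \<le> x"; cases "0 \<le> y")
      (auto simp: ennreal_neg ennreal_plus[symmetric] simp del: ennreal_plus intro: ennreal_leI)
  from this[of "M u" "u * v - M u"]
  have "ennreal (v * u) \<le> ennreal (M u) + ennreal (u * v - M u)" by (simp add: mult.commute)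
  also have "\<dots> \<le> ennreal (M u) + conjugate M v"
    unfolding conjugate_def using assms by (intro add_left_mono SUP_upper) auto
  finally show ?thesis .
qed

lemma orlicz_function_nonneg: "orlicz_function M \<Longrightarrow> 0 \<le> u \<Longrightarrow> 0 \<le> M u"
  unfolding orlicz_function_def mono_on_def by force

lemma orlicz_function_mono: "orlicz_function M \<Longrightarrow> 0 \<le> u \<Longrightarrow> u \<le> v \<Longrightarrow> M u \<le> M v"
  unfolding orlicz_function_def mono_on_def by force

lemma orlicz_function_divide_le:
  assumes "orlicz_function M" "0 \<le> u" "1 \<le> c"
  shows "M (u / c) \<le> M u / c"
proof -
  have "convex_on {0..} M" "M 0 = 0" using assms(1) by (auto simp: orlicz_function_def)
  then have "M ((1 - 1 / c) *\<^sub>R 0 + (1 / c) *\<^sub>R u) \<le> (1 - 1 / c) * M 0 + (1 / c) * M u"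
    using assms by (intro convex_onD) auto
  then show ?thesis using \<open>M 0 = 0\<close> by simp
qed

text \<open>By convexity, the conjugate lies below its chord over \<open>[0, 1]\<close>, whose end values are
  \<open>0\<close> and \<open>1\<close>.\<close>

lemma conjugate_le_self:
  assumes "orlicz_function M" "conjugate M 1 = 1" "0 \<le> v" "v \<le> 1"
  shows "conjugate M v \<le> ennreal v"
  unfolding conjugate_def
proof (rule SUP_least)
  fix u :: real assume "u \<in> {0..}"
  then have u: "0 \<le> u" by simp
  have "ennreal (u * 1 - M u) \<le> conjugate M 1"
    unfolding conjugate_def using u by (intro SUP_upper) auto
  then have "ennreal (u * 1 - M u) \<le> ennreal 1" using assms(2) by simp
  then have "u - M u \<le> 1" by (subst (asm) ennreal_le_iff) auto
  then have "v * (u - M u) \<le> v" using assms(3) by (intro mult_left_le) auto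
  moreover have "(1 - v) * M u \<ge> 0" using assms orlicz_function_nonneg[OF assms(1) u] by simp
  ultimately have "u * v - M u \<le> v" by (simp add: algebra_simps)
  then show "ennreal (u * v - M u) \<le> ennreal v" by (rule ennreal_leI)
qed

lemma orlicz_space_iff:
  "f \<in> orlicz_space M \<longleftrightarrow>
    (\<exists>a>0. \<forall>F. finite F \<longrightarrow> (\<Sum>k\<in>F. ennreal (M k (cmod (fourier_coeff f k) / a))) \<le> 1)"
  unfolding orlicz_space_def INF_less_iff infsum_ennreal_le_iff by auto

locale orlicz_family =
  fixes M :: "int \<Rightarrow> real \<Rightarrow> real"
  assumes orlicz: "orlicz_function (M k)"
    and conjugate_one: "conjugate (M k) 1 = 1"
begin

lemma orlicz_space_dominated:
  assumes g: "g \<in> orlicz_space M" and le: "\<And>k. cmod (fourier_coeff f k) \<le> C * cmod (fourier_coeff g k)"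
  shows "f \<in> orlicz_space M"
proof -
  obtain a where a: "a > 0" "\<And>F. finite F \<Longrightarrow> (\<Sum>k\<in>F. ennreal (M k (cmod (fourier_coeff g k) / a))) \<le> 1"
    using g unfolding orlicz_space_iff by blast
  define D where "D = max 1 C"
  have D: "D > 0" "C \<le> D" by (auto simp: D_def)
  have "(\<Sum>k\<in>F. ennreal (M k (cmod (fourier_coeff f k) / (a * D)))) \<le> 1" if "finite F" for F
  proof -
    have "M k (cmod (fourier_coeff f k) / (a * D)) \<le> M k (cmod (fourier_coeff g k) / a)" for k
    proof (rule orlicz_function_mono[OF orlicz])
      have "cmod (fourier_coeff f k) \<le> D * cmod (fourier_coeff g k)"
        using le[of k] mult_right_mono[OF D(2), of "cmod (fourier_coeff g k)"] by simp
      then show "cmod (fourier_coeff f k) / (a * D) \<le> cmod (fourier_coeff g k) / a"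
        using a(1) D(1) by (simp add: field_simps)
    qed (use a D in auto)
    then show ?thesis
      using a(2)[OF that] by (intro order_trans[OF sum_mono a(2)[OF that]]) (auto intro: ennreal_leI)
  qed
  then show ?thesis unfolding orlicz_space_iff using a D by (intro exI[of _ "a * D"]) auto
qed

lemma orlicz_space_finite_support:
  assumes T: "finite T" and zero: "\<And>k. k \<notin> T \<Longrightarrow> fourier_coeff f k = 0"
  shows "f \<in> orlicz_space M"
proof -
  define a where "a = 1 + (\<Sum>k\<in>T. M k (cmod (fourier_coeff f k)))"
  have pos: "0 \<le> M k (cmod (fourier_coeff f k))" for k
    by (rule orlicz_function_nonneg[OF orlicz]) simp
  have a: "1 \<le> a" unfolding a_def using pos by (simp add: sum_nonneg)
  have "(\<Sum>k\<in>F. ennreal (M k (cmod (fourier_coeff f k) / a))) \<le> 1" if "finite F" for F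
  proof -
    have M0: "M k 0 = 0" for k using orlicz[of k] by (simp add: orlicz_function_def)
    have "(\<Sum>k\<in>F. ennreal (M k (cmod (fourier_coeff f k) / a)))
        = (\<Sum>k\<in>F \<inter> T. ennreal (M k (cmod (fourier_coeff f k) / a)))"
      using that zero M0 by (intro sum.mono_neutral_right) auto
    also have "\<dots> \<le> (\<Sum>k\<in>T. ennreal (M k (cmod (fourier_coeff f k) / a)))"
      using T by (intro sum_mono2) auto
    also have "\<dots> \<le> (\<Sum>k\<in>T. ennreal (M k (cmod (fourier_coeff f k)) / a))"
      using a by (intro sum_mono ennreal_leI orlicz_function_divide_le[OF orlicz]) auto
    also have "\<dots> = ennreal ((\<Sum>k\<in>T. M k (cmod (fourier_coeff f k))) / a)"
      using a pos by (simp add: sum_ennreal sum_divide_distrib)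
    also have "\<dots> \<le> 1" using a by (simp add: a_def divide_le_eq)
    finally show ?thesis .
  qed
  then show ?thesis unfolding orlicz_space_iff using a by (intro exI[of _ a]) auto
qed

text \<open>Young's inequality bounds the norm by twice any admissible scaling \<open>a\<close>, hence by twice the
  Luxemburg norm.\<close>

lemma orlicz_norm_finite:
  assumes "f \<in> orlicz_space M"
  shows "orlicz_norm M f < \<infinity>"
proof -
  obtain a where a: "a > 0" "\<And>F. finite F \<Longrightarrow> (\<Sum>k\<in>F. ennreal (M k (cmod (fourier_coeff f k) / a))) \<le> 1"
    using assms unfolding orlicz_space_iff by blast
  have "orlicz_norm M f \<le> ennreal a * 2"
    unfolding orlicz_norm_def orlicz_norm_seq_le_iff
  proof (intro ballI allI impI)
    fix l and F :: "int set"
    assume l: "l \<in> dual_sequences M" and F: "finite F"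
    have "(\<Sum>k\<in>F. ennreal (l k * cmod (fourier_coeff f k)))
        = ennreal a * (\<Sum>k\<in>F. ennreal (l k * (cmod (fourier_coeff f k) / a)))"
      unfolding sum_distrib_left using a(1)
      by (intro sum.cong) (auto simp: ennreal_mult'[symmetric])
    also have "(\<Sum>k\<in>F. ennreal (l k * (cmod (fourier_coeff f k) / a)))
        \<le> (\<Sum>k\<in>F. ennreal (M k (cmod (fourier_coeff f k) / a)) + conjugate (M k) (l k))"
      using a(1) by (intro sum_mono young_le_conjugate) auto
    also have "\<dots> \<le> 1 + 1"
      unfolding sum.distrib using l F
      by (intro add_mono a(2)) (auto simp: dual_sequences_def infsum_ennreal_le_iff)
    finally show "(\<Sum>k\<in>F. ennreal (l k * cmod (fourier_coeff f k))) \<le> ennreal a * 2"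
      by (simp add: mult_left_mono one_add_one)
  qed
  also have "\<dots> < \<infinity>" by (simp add: ennreal_mult_less_top)
  finally show ?thesis .
qed

text \<open>This is where the normalization of the conjugates at \<open>1\<close> enters: a weight arbitrarily close to
  \<open>1\<close> may be put on a single index \<open>k\<close>, since the remaining budget \<open>d\<close> can be spread over all other
  indices in positive portions of total size at most \<open>d\<close>.\<close>

lemma coeff_le_orlicz_norm_seq: "ennreal (cmod (c k)) \<le> orlicz_norm_seq M c"
proof -
  have *: "ennreal ((1 - d) * cmod (c k)) \<le> orlicz_norm_seq M c" if d: "0 < d" "d < 1" for d
  proof -
    \<comment> \<open>\<open>int_encode\<close> enumerates the integers, so these weights sum up to \<open>d\<close>.\<close>
    define w :: "int \<Rightarrow> real" where "w j = d * (1 / 2) ^ Suc (int_encode j)" for j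
    define l where "l = w(k := 1 - d)"
    have w: "0 < w j" "w j \<le> 1" for j
      using d unfolding w_def by (auto intro!: mult_le_one power_le_one simp del: power_Suc)
    have sumw: "sum w F \<le> d" if "finite F" for F
    proof -
      have "sum w F = d * (\<Sum>i\<in>int_encode ` F. (1 / 2) ^ Suc i)"
        by (simp add: w_def sum_distrib_left sum.reindex inj_int_encode o_def)
      also have "(\<Sum>i\<in>int_encode ` F. (1 / 2 :: real) ^ Suc i) \<le> 1"
        using sum_le_suminf[OF sums_summable[OF power_half_series], of "int_encode ` F"] that
          sums_unique[OF power_half_series] by simp
      finally show ?thesis using d by simp
    qed
    have "l \<in> dual_sequences M"
      unfolding dual_sequences_def infsum_ennreal_le_iff
    proof (intro CollectI conjI allI impI)
      show "0 < l j" for j using w d by (simp add: l_def)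
      fix F :: "int set" assume F: "finite F"
      have "(\<Sum>j\<in>F. conjugate (M j) (l j)) \<le> (\<Sum>j\<in>F. ennreal (l j))"
        using w d by (intro sum_mono conjugate_le_self orlicz conjugate_one) (auto simp: l_def less_imp_le)
      also have "\<dots> = ennreal (sum l F)"
        using w d by (intro sum_ennreal) (auto simp: l_def less_imp_le)
      also have "sum l F \<le> sum l (insert k F)"
        using F w d by (intro sum_mono2) (auto simp: l_def less_imp_le)
      also have "sum l (insert k F) = (1 - d) + sum w (F - {k})"
        using F by (subst sum.insert_remove) (auto simp: l_def intro!: sum.cong)
      also have "\<dots> \<le> 1" using sumw[of "F - {k}"] F by simp
      finally show "(\<Sum>j\<in>F. conjugate (M j) (l j)) \<le> 1" by (simp add: ennreal_leI)
    qed
    then show ?thesis using sum_le_orlicz_norm_seq[of l M "{k}" c] by (simp add: l_def)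
  qed
  show ?thesis
  proof (rule ccontr)
    assume "\<not> ?thesis"
    then obtain r where r: "orlicz_norm_seq M c = ennreal r" "0 \<le> r" "r < cmod (c k)"
      by (cases "orlicz_norm_seq M c") (auto simp: not_le ennreal_less_iff)
    define d where "d = (cmod (c k) - r) / (2 * cmod (c k))"
    have "0 < cmod (c k)" using r by linarith
    then have d: "0 < d" "d < 1" "d * cmod (c k) = (cmod (c k) - r) / 2"
      using r by (auto simp: d_def field_simps)
    have "(1 - d) * cmod (c k) \<le> r"
      using *[OF d(1,2)] r by simp
    then have "cmod (c k) - (cmod (c k) - r) / 2 \<le> r" by (simp add: left_diff_distrib d(3))
    then show False using r(3) by (simp add: field_simps)
  qed
qed

end

section \<open>Partial sums of Fourier series\<close>

definition partial_sum :: "int set \<Rightarrow> per_L1 \<Rightarrow> per_L1" where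
  "partial_sum T f = (\<Sum>k\<in>T. scale_L1 (fourier_coeff f k) (harmonic k))"

lemma fourier_coeff_harmonic_sum:
  assumes "finite T"
  shows "fourier_coeff (\<Sum>k\<in>T. scale_L1 (c k) (harmonic k)) j = (if j \<in> T then c j else 0)"
  using assms by (simp add: fourier_coeff_sum fourier_coeff_scale fourier_coeff_harmonic if_distrib cong: if_cong)

lemma fourier_coeff_partial_sum:
  "finite T \<Longrightarrow> fourier_coeff (partial_sum T f) j = (if j \<in> T then fourier_coeff f j else 0)"
  by (simp add: partial_sum_def fourier_coeff_harmonic_sum)

lemma harmonic_sum_in_span:
  "(\<Sum>k\<in>T. scale_L1 (c k) (harmonic k)) \<in> L1.span (harmonic ` T)"
  by (intro L1.span_sum L1.span_scale L1.span_base) auto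

lemma partial_sum_in_span: "partial_sum T f \<in> L1.span (harmonic ` T)"
  unfolding partial_sum_def by (rule harmonic_sum_in_span)

lemma partial_sum_add: "partial_sum T (f + g) = partial_sum T f + partial_sum T g"
  by (simp add: partial_sum_def fourier_coeff_add L1.scale_left_distrib sum.distrib)

lemma partial_sum_scale: "partial_sum T (scale_L1 c f) = scale_L1 c (partial_sum T f)"
  by (simp add: partial_sum_def fourier_coeff_scale L1.scale_sum_right)

lemma partial_sum_zero: "partial_sum T 0 = 0"
  by (simp add: partial_sum_def fourier_coeff_zero)

lemma partial_sum_span:
  assumes T: "finite T" and f: "f \<in> L1.span (harmonic ` T)"
  shows "partial_sum T f = f"
  using f
proof (induction rule: L1.span_induct_alt)
  case base
  then show ?case by (rule partial_sum_zero)
next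
  case (step c x y)
  then obtain m where m: "x = harmonic m" "m \<in> T" by auto
  have "partial_sum T x = (\<Sum>k\<in>T. if k = m then harmonic m else 0)"
    unfolding partial_sum_def m fourier_coeff_harmonic by (intro sum.cong) auto
  also have "\<dots> = x" using T m by simp
  finally show ?case using step by (simp add: partial_sum_add partial_sum_scale)
qed

lemma fourier_coeff_span_eq_0:
  assumes "finite T" "f \<in> L1.span (harmonic ` T)" "k \<notin> T"
  shows "fourier_coeff f k = 0"
  using fourier_coeff_partial_sum[OF assms(1), of f k] partial_sum_span[OF assms(1,2)] assms(3) by simp

lemma inj_harmonic: "inj harmonic"
proof (rule injI)
  fix k m assume "harmonic k = harmonic m"
  then have "fourier_coeff (harmonic k) k = fourier_coeff (harmonic m) k" by simp
  then show "k = m" by (simp add: fourier_coeff_harmonic split: if_splits)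
qed

lemma independent_harmonic:
  assumes T: "finite T"
  shows "L1.independent (harmonic ` T)"
proof
  assume "L1.dependent (harmonic ` T)"
  then obtain u where u: "\<exists>v\<in>harmonic ` T. u v \<noteq> 0" "(\<Sum>v\<in>harmonic ` T. scale_L1 (u v) v) = 0"
    using T by (auto simp: L1.dependent_finite)
  then have "(\<Sum>k\<in>T. scale_L1 (u (harmonic k)) (harmonic k)) = 0"
    by (simp add: sum.reindex inj_on_subset[OF inj_harmonic])
  then have "fourier_coeff (\<Sum>k\<in>T. scale_L1 (u (harmonic k)) (harmonic k)) j = 0" for j
    by (simp add: fourier_coeff_zero)
  then have "u (harmonic j) = 0" if "j \<in> T" for j
    using fourier_coeff_harmonic_sum[OF T, of "\<lambda>k. u (harmonic k)" j] that by simp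
  then show False using u(1) by auto
qed

context orlicz_family
begin

lemma span_harmonic_subset:
  "finite T \<Longrightarrow> L1.span (harmonic ` T) \<subseteq> orlicz_space M"
  using fourier_coeff_span_eq_0 orlicz_space_finite_support by blast

lemma span_harmonic_subspace_of_dim:
  assumes "finite T"
  shows "L1.span (harmonic ` T) \<in> subspaces_of_dim M (card T)"
  unfolding subspaces_of_dim_def
  using assms span_harmonic_subset independent_harmonic card_image[OF inj_on_subset[OF inj_harmonic]]
  by (intro CollectI conjI exI[of _ "harmonic ` T"]) auto

lemma partial_sum_projection:
  assumes "finite T"
  shows "partial_sum T \<in> projections M (L1.span (harmonic ` T))"
  using partial_sum_span[OF assms]
  by (auto simp: projections_def linear_operators_def partial_sum_in_span partial_sum_add partial_sum_scale)

lemma orlicz_norm_pos: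
  assumes "f \<noteq> 0" shows "0 < orlicz_norm M f"
proof -
  obtain k where "fourier_coeff f k \<noteq> 0" using fourier_coeff_eq_zero_imp assms by blast
  then have "0 < ennreal (cmod (fourier_coeff f k))" by simp
  also have "\<dots> \<le> orlicz_norm M f" unfolding orlicz_norm_def by (rule coeff_le_orlicz_norm_seq)
  finally show ?thesis .
qed

lemma orlicz_norm_scale_le: "orlicz_norm M (scale_L1 c f) \<le> ennreal (cmod c) * orlicz_norm M f"
  unfolding orlicz_norm_def
  by (rule orlicz_norm_seq_le_cmult) (simp_all add: fourier_coeff_scale norm_mult)

lemma orlicz_space_scale: "f \<in> orlicz_space M \<Longrightarrow> scale_L1 c f \<in> orlicz_space M"
  by (rule orlicz_space_dominated[of f _ "cmod c"]) (simp_all add: fourier_coeff_scale norm_mult)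

text \<open>The norm of a nonzero element is positive (by uniqueness of Fourier coefficients) and finite,
  so it can be scaled into the unit ball.\<close>

lemma normalize_in_ball:
  assumes "f \<in> orlicz_space M" "f \<noteq> 0"
  obtains r where "0 < r" "orlicz_norm M f = ennreal r" "scale_L1 (complex_of_real (1 / r)) f \<in> orlicz_ball M"
proof -
  obtain r where r: "orlicz_norm M f = ennreal r" "0 < r"
    using orlicz_norm_finite[OF assms(1)] orlicz_norm_pos[OF assms(2)]
    by (cases "orlicz_norm M f") auto
  have "orlicz_norm M (scale_L1 (complex_of_real (1 / r)) f) \<le> ennreal (1 / r) * ennreal r"
    using orlicz_norm_scale_le[of "complex_of_real (1 / r)" f] r by (simp add: norm_divide)
  also have "\<dots> = 1" using r by (simp add: ennreal_mult'[symmetric])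
  finally show ?thesis
    using that r orlicz_space_scale[OF assms(1)] by (auto simp: orlicz_ball_def)
qed

end

section \<open>Bounds for widths\<close>

context orlicz_family
begin

text \<open>The unit ball of a coordinate subspace \<open>X\<close> of dimension \<open>N + 1\<close> has \<open>N\<close>-width at least \<open>1\<close>.
  In a general normed space this needs a topological argument, but here truncation to the
  coordinates \<open>T\<close> is a contraction onto \<open>X\<close>. Given \<open>F\<close> of dimension \<open>N\<close>, a dimension count
  yields a nonzero functional \<open>p\<close> on the coordinates in \<open>T\<close> that vanishes on \<open>F\<close>. If \<open>q\<close> is its
  norm on \<open>X\<close>, then \<open>q\<close> bounds \<open>p\<close> on the whole space, because \<open>p\<close> sees only the truncation.
  For \<open>y\<close> in the ball at which \<open>p\<close> almost attains \<open>q\<close> and for \<open>u\<close> in \<open>F\<close>, the identity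
  \<open>p y = p (y - u)\<close> forces the norm of \<open>y - u\<close> to be almost \<open>1\<close>.\<close>

lemma le_kolmogorov_width:
  assumes T: "finite T" "card T = N + 1" and e: "0 < e"
    and K: "scale_L1 (complex_of_real e) ` orlicz_ball M \<inter> L1.span (harmonic ` T) \<subseteq> K"
  shows "ennreal e \<le> kolmogorov_width M N K"
  unfolding kolmogorov_width_def
proof (rule INF_greatest)
  fix F assume "F \<in> subspaces_of_dim M N"
  then obtain B where B: "finite B" "card B = N" "F = L1.span B"
    by (auto simp: subspaces_of_dim_def)
  obtain a where a: "\<exists>k\<in>T. a k \<noteq> 0" "\<And>b. b \<in> B \<Longrightarrow> (\<Sum>k\<in>T. a k * fourier_coeff b k) = 0"
    using homogeneous_system_nontrivial[OF B(1) T(1), of "\<lambda>b. fourier_coeff b"] B T by auto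
  define p where "p f = (\<Sum>k\<in>T. a k * fourier_coeff f k)" for f
  have p_scale: "p (scale_L1 c f) = c * p f" for c f
    by (simp add: p_def fourier_coeff_scale sum_distrib_left mult.left_commute)
  have p_add: "p (f + g) = p f + p g" for f g
    by (simp add: p_def fourier_coeff_add distrib_left sum.distrib)
  have p_diff: "p (f - g) = p f - p g" for f g
    by (simp add: p_def fourier_coeff_diff right_diff_distrib sum_subtractf)
  have pF: "p u = 0" if "u \<in> F" for u
    using that unfolding B(3)
  proof (induction rule: L1.span_induct_alt)
    case base
    then show ?case by (simp add: p_def fourier_coeff_zero)
  next
    case (step c x y)
    then show ?case using a(2) by (simp add: p_add p_scale) (simp add: p_def)
  qed
  define Y where "Y = orlicz_ball M \<inter> L1.span (harmonic ` T)"
  define q where "q = (SUP y\<in>Y. ennreal (cmod (p y)))"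
  have q_bound: "ennreal (cmod (p f)) \<le> q * orlicz_norm M f" if f: "f \<in> L1.span (harmonic ` T)" for f
  proof (cases "f = 0")
    case True
    then show ?thesis by (simp add: p_def fourier_coeff_zero)
  next
    case False
    then obtain r where r: "0 < r" "orlicz_norm M f = ennreal r"
      "scale_L1 (complex_of_real (1 / r)) f \<in> orlicz_ball M"
      using normalize_in_ball[of f] f span_harmonic_subset[OF T(1)] by blast
    then have "scale_L1 (complex_of_real (1 / r)) f \<in> Y"
      using f L1.span_scale by (auto simp: Y_def)
    then have "ennreal (cmod (p (scale_L1 (complex_of_real (1 / r)) f))) \<le> q"
      unfolding q_def by (rule SUP_upper)
    then have "ennreal (cmod (p f) / r) * ennreal r \<le> q * ennreal r"
      using r by (intro mult_right_mono) (simp_all add: p_scale norm_divide)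
    then show ?thesis using r by (simp add: ennreal_mult'[symmetric])
  qed
  have q_bound': "ennreal (cmod (p f)) \<le> q * orlicz_norm M f" for f
  proof -
    have "p f = p (partial_sum T f)"
      unfolding p_def using T by (simp add: fourier_coeff_partial_sum)
    also have "ennreal (cmod \<dots>) \<le> q * orlicz_norm M (partial_sum T f)"
      by (intro q_bound partial_sum_in_span)
    also have "\<dots> \<le> q * orlicz_norm M f"
      unfolding orlicz_norm_def
      using T by (intro mult_left_mono orlicz_norm_seq_mono) (auto simp: fourier_coeff_partial_sum)
    finally show ?thesis .
  qed
  have "q \<noteq> 0"
  proof
    assume "q = 0"
    \<comment> \<open>The functional does not vanish at the vector of its conjugate coefficients.\<close>
    define f where "f = (\<Sum>k\<in>T. scale_L1 (cnj (a k)) (harmonic k))"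
    have "p f = (\<Sum>k\<in>T. of_real ((cmod (a k))\<^sup>2))"
      unfolding p_def f_def using T
      by (intro sum.cong) (auto simp: fourier_coeff_harmonic_sum complex_norm_square[symmetric])
    also have "\<dots> = of_real (\<Sum>k\<in>T. (cmod (a k))\<^sup>2)" by simp
    finally have "p f = of_real (\<Sum>k\<in>T. (cmod (a k))\<^sup>2)" .
    moreover have "(\<Sum>k\<in>T. (cmod (a k))\<^sup>2) \<noteq> 0"
      using a(1) T by (subst sum_nonneg_eq_0_iff) auto
    moreover have "p f = 0" using q_bound'[of f] \<open>q = 0\<close> by simp
    ultimately show False by (metis of_real_eq_0_iff)
  qed
  have "q \<le> ennreal (\<Sum>k\<in>T. cmod (a k))"
    unfolding q_def
  proof (intro SUP_least ennreal_leI)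
    fix y assume "y \<in> Y"
    have "cmod (fourier_coeff y k) \<le> 1" for k
    proof -
      have "ennreal (cmod (fourier_coeff y k)) \<le> 1"
        using \<open>y \<in> Y\<close> order_trans[OF coeff_le_orlicz_norm_seq[of "fourier_coeff y" k], of 1]
        by (auto simp: Y_def orlicz_ball_def orlicz_norm_def)
      then show ?thesis by simp
    qed
    then show "cmod (p y) \<le> (\<Sum>k\<in>T. cmod (a k))"
      unfolding p_def by (intro sum_norm_le) (simp add: norm_mult mult_left_le)
  qed
  then have "q \<noteq> top" by (auto simp: top_unique)
  define S where "S = (SUP f\<in>K. INF u\<in>F. orlicz_norm M (f - u))"
  have "ennreal e * ennreal (cmod (p y)) \<le> q * S" if "y \<in> Y" for y
  proof -
    let ?f = "scale_L1 (complex_of_real e) y"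
    have "?f \<in> K" using that K L1.span_scale by (auto simp: Y_def)
    have "ennreal e * ennreal (cmod (p y)) / q \<le> orlicz_norm M (?f - u)" if "u \<in> F" for u
    proof (rule divide_le_posI_ennreal)
      show "0 < q" using \<open>q \<noteq> 0\<close> by (simp add: zero_less_iff_neq_zero)
      have "ennreal e * ennreal (cmod (p y)) = ennreal (cmod (p (?f - u)))"
        using e pF[OF that] by (simp add: p_diff p_scale norm_mult ennreal_mult)
      then show "ennreal e * ennreal (cmod (p y)) \<le> q * orlicz_norm M (?f - u)"
        using q_bound' by simp
    qed
    then have "ennreal e * ennreal (cmod (p y)) / q \<le> (INF u\<in>F. orlicz_norm M (?f - u))"
      by (rule INF_greatest)
    also have "\<dots> \<le> S" unfolding S_def by (rule SUP_upper[OF \<open>?f \<in> K\<close>])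
    finally have "q * (ennreal e * ennreal (cmod (p y)) / q) \<le> q * S" by (rule mult_left_mono) simp
    then show ?thesis
      using \<open>q \<noteq> 0\<close> \<open>q \<noteq> top\<close> by (simp add: ennreal_times_divide mult_divide_eq_ennreal mult.commute[of q])
  qed
  then have "ennreal e * q \<le> q * S"
    unfolding q_def SUP_mult_left_ennreal by (intro SUP_least)
  then show "ennreal e \<le> (SUP f\<in>K. INF u\<in>F. orlicz_norm M (f - u))"
    using \<open>q \<noteq> 0\<close> \<open>q \<noteq> top\<close> unfolding S_def[symmetric]
    by (simp add: mult.commute[of _ q] ennreal_mult_le_mult_iff)
qed

lemma le_bernstein_width:
  assumes T: "finite T" "card T = N + 1" and e: "0 < e"
    and K: "scale_L1 (complex_of_real e) ` orlicz_ball M \<inter> L1.span (harmonic ` T) \<subseteq> K"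
  shows "ennreal e \<le> bernstein_width M N K"
  unfolding bernstein_width_def
  using span_harmonic_subspace_of_dim[OF T(1)] T(2) e K
  by (intro SUP_upper2[of "L1.span (harmonic ` T)"] SUP_upper2[of e]) auto

lemma kolmogorov_le_linear_width:
  assumes "K \<subseteq> orlicz_space M"
  shows "kolmogorov_width M N K \<le> linear_width M N K"
  unfolding kolmogorov_width_def linear_width_def
proof (intro INF_mono, rule bexI, rule INF_greatest)
  fix F A assume "A \<in> linear_operators M F"
  then have "(INF u\<in>F. orlicz_norm M (f - u)) \<le> orlicz_norm M (f - A f)" if "f \<in> K" for f
    using that assms by (intro INF_lower) (auto simp: linear_operators_def)
  then show "(SUP f\<in>K. INF u\<in>F. orlicz_norm M (f - u)) \<le> (SUP f\<in>K. orlicz_norm M (f - A f))"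
    by (intro SUP_mono) blast
qed

lemma linear_le_projection_width: "linear_width M N K \<le> projection_width M N K"
  unfolding projection_width_def linear_width_def
  by (intro INF_mono bexI INF_superset_mono) (auto simp: projections_def)

lemma projection_width_le:
  assumes T: "finite T" "card T = N"
    and K: "\<And>f. f \<in> K \<Longrightarrow> orlicz_norm M (f - partial_sum T f) \<le> C"
  shows "projection_width M N K \<le> C"
  unfolding projection_width_def
  using span_harmonic_subspace_of_dim[OF T(1)] T(2) partial_sum_projection[OF T(1)] K
  by (intro INF_lower2[of "L1.span (harmonic ` T)"] INF_lower2[of "partial_sum T"] SUP_least) auto

text \<open>A subspace of dimension \<open>N + 1\<close> contains a nonzero \<open>f\<close> that is annihilated by at most \<open>N\<close> given
  coefficient functionals. Scaled to norm \<open>e\<close>, it belongs to \<open>K\<close>.\<close>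

lemma bernstein_width_le:
  assumes T: "finite T" "card T \<le> N"
    and K: "\<And>f. f \<in> K \<Longrightarrow> (\<And>k. k \<in> T \<Longrightarrow> fourier_coeff f k = 0) \<Longrightarrow> orlicz_norm M f \<le> C"
  shows "bernstein_width M N K \<le> C"
  unfolding bernstein_width_def
proof (intro SUP_least)
  fix F e assume F: "F \<in> subspaces_of_dim M (N + 1)"
    and "e \<in> {e. 0 < e \<and> scale_L1 (complex_of_real e) ` orlicz_ball M \<inter> F \<subseteq> K}"
  then have e: "0 < e" "scale_L1 (complex_of_real e) ` orlicz_ball M \<inter> F \<subseteq> K" by auto
  obtain B where B: "finite B" "card B = N + 1" "L1.independent B" "F = L1.span B" "F \<subseteq> orlicz_space M"
    using F by (auto simp: subspaces_of_dim_def)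
  obtain x where x: "\<exists>b\<in>B. x b \<noteq> 0" "\<And>k. k \<in> T \<Longrightarrow> (\<Sum>b\<in>B. x b * fourier_coeff b k) = 0"
    using homogeneous_system_nontrivial[OF T(1) B(1), of "\<lambda>k b. fourier_coeff b k"] B T by auto
  define f where "f = (\<Sum>b\<in>B. scale_L1 (x b) b)"
  have f0: "f \<noteq> 0" using x(1) B(1,3) by (auto simp: f_def L1.dependent_finite)
  have fF: "f \<in> F" unfolding f_def B(4) by (intro L1.span_sum L1.span_scale L1.span_base)
  have fT: "fourier_coeff f k = 0" if "k \<in> T" for k
    using x(2)[OF that] by (simp add: f_def fourier_coeff_sum fourier_coeff_scale)
  obtain r where r: "0 < r" "orlicz_norm M f = ennreal r" "scale_L1 (complex_of_real (1 / r)) f \<in> orlicz_ball M"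
    using normalize_in_ball[of f] f0 fF B(5) by blast
  define h where "h = scale_L1 (complex_of_real e) (scale_L1 (complex_of_real (1 / r)) f)"
  have "h \<in> K"
    using e(2) r(3) fF L1.span_scale unfolding h_def B(4) by blast
  have "scale_L1 (complex_of_real (r / e)) h = f" "cmod (complex_of_real (r / e)) = r / e"
    using r e by (simp_all add: h_def norm_divide)
  then have "ennreal r \<le> ennreal (r / e) * orlicz_norm M h"
    using orlicz_norm_scale_le[of "complex_of_real (r / e)" h] r(2) by simp
  also have "\<dots> \<le> ennreal (r / e) * C"
    using K[OF \<open>h \<in> K\<close>] fT by (intro mult_left_mono) (auto simp: h_def fourier_coeff_scale)
  finally have "ennreal (e / r) * ennreal r \<le> ennreal (e / r) * (ennreal (r / e) * C)"
    by (rule mult_left_mono) simp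
  then show "ennreal e \<le> C"
    using r e by (simp add: ennreal_mult'[symmetric] mult.assoc[symmetric])
qed

end

section \<open>Jackson and Bernstein type inequalities\<close>

lemma Psi_set_antimono:
  assumes psi: "\<psi> \<in> Psi_set" and j: "1 \<le> j" "j \<le> \<bar>k\<bar>"
  shows "cmod (\<psi> k) \<le> cmod (\<psi> j)"
proof -
  have refl: "cmod (\<psi> (- i)) = cmod (\<psi> i)" and decr: "cmod (\<psi> (i + 1)) \<le> cmod (\<psi> i)" if "1 \<le> i" for i
    using psi that unfolding Psi_set_def by (metis (mono_tags, lifting) mem_Collect_eq)+
  have "cmod (\<psi> m) \<le> cmod (\<psi> j)" if "j \<le> m" for m
    using that
  proof (induction m rule: int_ge_induct)
    case (step m)
    then show ?case using \<open>1 \<le> j\<close> decr[of m] by simp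
  qed simp
  from this[of "\<bar>k\<bar>"] show ?thesis using refl[of "- k"] j by (cases "0 \<le> k") auto
qed

lemma Psi_set_bounded:
  assumes "\<psi> \<in> Psi_set"
  shows "cmod (\<psi> k) \<le> max (cmod (\<psi> 0)) (cmod (\<psi> 1))"
proof (cases "k = 0")
  case False
  then have "cmod (\<psi> k) \<le> cmod (\<psi> 1)" by (intro Psi_set_antimono assms) auto
  then show ?thesis by simp
qed simp

lemma Phi_set_abs: "\<phi> \<in> Phi_set \<Longrightarrow> \<phi> (of_int k * h) = \<phi> (of_int \<bar>k\<bar> * \<bar>h\<bar>)"
  by (cases "0 \<le> k"; cases "0 \<le> h") (auto simp: Phi_set_def)

lemma Phi_set_measurable:
  assumes "\<phi> \<in> Phi_set" shows "\<phi> \<in> borel_measurable borel"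
  using assms by (intro borel_measurable_continuous_onI) (auto simp: Phi_set_def)

lemma Delta_norm_le_modulus: "0 \<le> t \<Longrightarrow> Delta_norm M \<phi> t f \<le> modulus M \<phi> f t"
  unfolding modulus_def by (intro SUP_upper) auto

text \<open>The averaging step of the upper estimate. For \<open>\<bar>k\<bar> \<ge> n\<close> the mean of \<open>\<phi>(k t / n)\<close> is at least the
  infimum, so each weighted coefficient is dominated by its average over \<open>t\<close>; summing under the
  integral sign produces, for each \<open>t\<close>, a partial sum of the norm of the difference with step
  \<open>t / n\<close>, which is at most the modulus at \<open>t / n\<close>.\<close>

lemma I_inf_mult_sum_le_stieltjes_integral_modulus:
  assumes phi: "\<phi> \<in> Phi_set" and mu: "mono_on {0..\<tau>} \<mu>" and tau: "0 < \<tau>" and n: "1 \<le> n"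
    and F: "finite F" "\<And>k. k \<in> F \<Longrightarrow> int n \<le> \<bar>k\<bar>" and l: "l \<in> dual_sequences M"
  shows "I_inf n \<phi> \<tau> \<mu> * (\<Sum>k\<in>F. ennreal (l k * cmod (fourier_coeff g k)))
    \<le> stieltjes_integral 0 (\<tau> / n) (modulus M \<phi> g) (\<lambda>t. \<mu> (\<tau> * t / (\<tau> / n)))"
proof -
  define x where "x k = ennreal (l k * cmod (fourier_coeff g k))" for k
  define H where "H s = (\<Sum>k\<in>F. x k * ennreal (\<phi> (of_int \<bar>k\<bar> * s)))" for s
  note [measurable] = Phi_set_measurable[OF phi]
  have nonneg: "0 \<le> \<phi> t" for t using phi by (simp add: Phi_set_def)
  have H_le: "H s \<le> modulus M \<phi> g s" if "0 \<le> s" for s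
  proof -
    have "H s = (\<Sum>k\<in>F. ennreal (l k * cmod (complex_of_real (\<phi> (of_int k * s)) * fourier_coeff g k)))"
      unfolding H_def x_def
    proof (intro sum.cong refl)
      fix k
      have "\<phi> (of_int \<bar>k\<bar> * s) = \<phi> (of_int k * s)"
        using Phi_set_abs[OF phi, of k s] that by simp
      then show "ennreal (l k * cmod (fourier_coeff g k)) * ennreal (\<phi> (of_int \<bar>k\<bar> * s))
          = ennreal (l k * cmod (complex_of_real (\<phi> (of_int k * s)) * fourier_coeff g k))"
        using nonneg dual_sequence_pos[OF l, of k]
        by (simp add: ennreal_mult[symmetric] norm_mult mult_ac)
    qed
    also have "\<dots> \<le> Delta_norm M \<phi> s g"
      unfolding Delta_norm_def by (rule sum_le_orlicz_norm_seq[OF l F(1)])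
    also have "\<dots> \<le> modulus M \<phi> g s" by (rule Delta_norm_le_modulus[OF that])
    finally show ?thesis .
  qed
  have "I_inf n \<phi> \<tau> \<mu> * (\<Sum>k\<in>F. x k)
      \<le> (\<Sum>k\<in>F. x k * stieltjes_integral 0 \<tau> (\<lambda>t. ennreal (\<phi> (of_int \<bar>k\<bar> * (1 / n * t)))) \<mu>)"
    unfolding sum_distrib_left
  proof (rule sum_mono)
    fix k assume "k \<in> F"
    have "I_inf n \<phi> \<tau> \<mu> \<le> stieltjes_integral 0 \<tau> (\<lambda>t. ennreal (\<phi> (real (nat \<bar>k\<bar>) * t / real n))) \<mu>"
      unfolding I_inf_def using F(2)[OF \<open>k \<in> F\<close>] by (intro INF_lower) auto
    also have "(\<lambda>t. ennreal (\<phi> (real (nat \<bar>k\<bar>) * t / real n))) = (\<lambda>t. ennreal (\<phi> (of_int \<bar>k\<bar> * (1 / n * t))))"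
      by simp
    finally show "I_inf n \<phi> \<tau> \<mu> * x k
        \<le> x k * stieltjes_integral 0 \<tau> (\<lambda>t. ennreal (\<phi> (of_int \<bar>k\<bar> * (1 / n * t)))) \<mu>"
      by (subst mult.commute) (rule mult_left_mono, simp_all)
  qed
  also have "\<dots> = (\<Sum>k\<in>F. stieltjes_integral 0 \<tau> (\<lambda>t. x k * ennreal (\<phi> (of_int \<bar>k\<bar> * (1 / n * t)))) \<mu>)"
    by (intro sum.cong refl stieltjes_integral_cmult[symmetric]) measurable
  also have "\<dots> = stieltjes_integral 0 \<tau> (\<lambda>t. H (1 / n * t)) \<mu>"
    unfolding H_def by (intro stieltjes_integral_sum[symmetric]) measurable
  also have "\<dots> = stieltjes_integral (1 / n * 0) (1 / n * \<tau>) H (\<lambda>t. \<mu> (t / (1 / n)))"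
  proof (rule stieltjes_integral_scale[symmetric])
    show "H \<in> borel_measurable borel" unfolding H_def by measurable
  qed (use n tau mu in auto)
  also have "\<dots> = stieltjes_integral 0 (\<tau> / n) H (\<lambda>t. \<mu> (\<tau> * t / (\<tau> / n)))"
    using tau by simp
  also have "\<dots> \<le> stieltjes_integral 0 (\<tau> / n) (modulus M \<phi> g) (\<lambda>t. \<mu> (\<tau> * t / (\<tau> / n)))"
    by (rule stieltjes_integral_mono) (simp add: H_le)
  finally show ?thesis by (simp add: x_def)
qed

lemma weight_functions_increment_pos:
  assumes "\<mu> \<in> weight_functions \<tau>" "0 < \<tau>"
  shows "\<mu> 0 < \<mu> \<tau>"
proof (rule ccontr)
  assume le: "\<not> \<mu> 0 < \<mu> \<tau>"
  have mono: "mono_on {0..\<tau>} \<mu>" using assms by (simp add: weight_functions_def)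
  have "\<mu> x = \<mu> 0" if "x \<in> {0..\<tau>}" for x
    using monotone_onD[OF mono, of 0 x] monotone_onD[OF mono, of x \<tau>] that le by auto
  then have "\<mu> constant_on {0..\<tau>}" unfolding constant_on_def by blast
  then show False using assms by (simp add: weight_functions_def)
qed

lemma stieltjes_integral_modulus_eq:
  assumes "0 < \<mu> \<tau> - \<mu> 0"
  shows "stieltjes_integral 0 u (modulus M \<phi> g) (\<lambda>t. \<mu> (\<tau> * t / u))
    = ennreal (\<mu> \<tau> - \<mu> 0) * mean_modulus M \<phi> g \<tau> \<mu> u"
  unfolding mean_modulus_def using assms
  by (simp add: mult.assoc[symmetric] ennreal_times_divide)

text \<open>The cases \<open>c = 0\<close> and \<open>c = \<infinity>\<close> are included; they correspond to a vanishing
  and to an infinite mean of \<open>\<phi>\<close>.\<close>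

lemma ennreal_le_divide:
  assumes "c * x \<le> ennreal d" "0 < d"
  shows "x \<le> ennreal d / c"
proof (cases "c = 0 \<or> x = 0")
  case True
  then show ?thesis using assms by auto
next
  case False
  then have "c \<noteq> top" "x \<noteq> top" using assms by (auto simp: ennreal_mult_top ennreal_top_mult top_unique)
  then have "x = x * c / c" using False by (simp add: mult_divide_eq_ennreal)
  also have "\<dots> \<le> ennreal d / c" using assms by (intro divide_right_mono_ennreal) (simp add: mult.commute)
  finally show ?thesis .
qed

text \<open>The Jackson type inequality for the part of \<open>f\<close> carried by the frequencies \<open>\<bar>k\<bar> \<ge> n\<close>, or by
  some of them: there \<open>\<bar>\<psi>(k)\<bar>\<close> is largest at \<open>k = n\<close>, and the \<open>\<psi>\<close>-derivative is controlled
  by its averaged modulus at the single point \<open>u = \<tau> / n\<close>. The function \<open>c\<close> may drop frequencies,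
  as the approximating subspace may contain one of the frequencies \<open>n\<close>, \<open>-n\<close>.\<close>

lemma psi_class_tail_le:
  assumes psi: "\<psi> \<in> Psi_set" and phi: "\<phi> \<in> Phi_set" and mu: "\<mu> \<in> weight_functions \<tau>"
    and tau: "0 < \<tau>" and n: "1 \<le> n" and Om: "0 < \<Omega> (\<tau> / n)"
    and f: "f \<in> psi_class M \<psi> \<phi> \<tau> \<mu> \<Omega>"
    and c: "\<And>k. c k = 0 \<or> int n \<le> \<bar>k\<bar> \<and> c k = fourier_coeff f k"
  shows "orlicz_norm_seq M c \<le> ennreal (\<mu> \<tau> - \<mu> 0) / I_inf n \<phi> \<tau> \<mu>
    * ennreal (cmod (\<psi> (int n))) * ennreal (\<Omega> (\<tau> / n))"
  unfolding orlicz_norm_seq_le_iff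
proof (intro ballI allI impI)
  fix l and F :: "int set"
  assume l: "l \<in> dual_sequences M" and F: "finite F"
  let ?D = "\<mu> \<tau> - \<mu> 0" and ?I = "I_inf n \<phi> \<tau> \<mu>"
  obtain g where g: "psi_integral_of \<psi> g f"
    and mean: "\<And>u. 0 < u \<Longrightarrow> u \<le> \<tau> \<Longrightarrow> mean_modulus M \<phi> g \<tau> \<mu> u \<le> ennreal (\<Omega> u)"
    using f by (auto simp: psi_class_def)
  have D: "0 < ?D" using weight_functions_increment_pos[OF mu tau] by simp
  define F' where "F' = {k \<in> F. int n \<le> \<bar>k\<bar>}"
  define x where "x = (\<Sum>k\<in>F'. ennreal (l k * cmod (fourier_coeff g k)))"
  have "?I * x \<le> ennreal ?D * mean_modulus M \<phi> g \<tau> \<mu> (\<tau> / n)"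
    unfolding x_def stieltjes_integral_modulus_eq[OF D, symmetric]
    using mu F by (intro I_inf_mult_sum_le_stieltjes_integral_modulus phi tau n l)
      (auto simp: weight_functions_def F'_def)
  also have "\<dots> \<le> ennreal ?D * ennreal (\<Omega> (\<tau> / n))"
    using tau n by (intro mult_left_mono mean) (auto simp: divide_le_eq)
  finally have Ix: "?I * x \<le> ennreal ?D * ennreal (\<Omega> (\<tau> / n))" .
  then have x: "x \<le> ennreal ?D * ennreal (\<Omega> (\<tau> / n)) / ?I"
    using D Om ennreal_le_divide[of ?I x "?D * \<Omega> (\<tau> / n)"] by (simp add: ennreal_mult)
  have "(\<Sum>k\<in>F. ennreal (l k * cmod (c k)))
      \<le> (\<Sum>k\<in>F. if int n \<le> \<bar>k\<bar> then ennreal (cmod (\<psi> (int n))) * ennreal (l k * cmod (fourier_coeff g k)) else 0)"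
  proof (rule sum_mono)
    fix k
    show "ennreal (l k * cmod (c k))
      \<le> (if int n \<le> \<bar>k\<bar> then ennreal (cmod (\<psi> (int n))) * ennreal (l k * cmod (fourier_coeff g k)) else 0)"
    proof (cases "c k = 0")
      case False
      then have k: "int n \<le> \<bar>k\<bar>" "c k = \<psi> k * fourier_coeff g k"
        using c[of k] g by (auto simp: psi_integral_of_def)
      have "cmod (\<psi> k) \<le> cmod (\<psi> (int n))" using Psi_set_antimono[OF psi _ k(1)] n by simp
      then have "l k * cmod (c k) \<le> cmod (\<psi> (int n)) * (l k * cmod (fourier_coeff g k))"
        using dual_sequence_pos[OF l, of k] unfolding k(2) norm_mult
        by (metis less_imp_le mult.left_commute mult_left_mono mult_right_mono norm_ge_zero mult_nonneg_nonneg)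
      then show ?thesis using k(1) by (simp add: ennreal_mult'[symmetric] ennreal_leI)
    qed simp
  qed
  also have "\<dots> = ennreal (cmod (\<psi> (int n))) * x"
    using F by (simp add: x_def F'_def sum_distrib_left sum.If_cases Int_def)
  also have "\<dots> \<le> ennreal (cmod (\<psi> (int n))) * (ennreal ?D * ennreal (\<Omega> (\<tau> / n)) / ?I)"
    using x by (rule mult_left_mono) simp
  also have "\<dots> = ennreal ?D / ?I * ennreal (cmod (\<psi> (int n))) * ennreal (\<Omega> (\<tau> / n))"
    by (simp add: divide_ennreal_def mult_ac)
  finally show "(\<Sum>k\<in>F. ennreal (l k * cmod (c k)))
      \<le> ennreal ?D / ?I * ennreal (cmod (\<psi> (int n))) * ennreal (\<Omega> (\<tau> / n))" .
qed

text \<open>Beyond \<open>a\<close> the function \<open>phi_star\<close> is constant at the supremum of \<open>\<phi>\<close>, hence it is a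
  nondecreasing majorant of \<open>\<phi>\<close> on the half-line.\<close>

lemma Phi_set_le_phi_star:
  assumes phi: "\<phi> \<in> Phi_set" and mono: "mono_on {0..a} \<phi>" and max: "\<phi> a = (SUP t. \<phi> t)"
    and "0 \<le> s" "s \<le> r"
  shows "\<phi> s \<le> phi_star \<phi> a r"
proof (cases "r \<le> a")
  case True
  then show ?thesis using assms by (auto simp: phi_star_def mono_on_def)
next
  case False
  have "bdd_above (range \<phi>)" using phi by (auto simp: Phi_set_def intro: bounded_imp_bdd_above)
  then have "\<phi> s \<le> (SUP t. \<phi> t)" by (intro cSUP_upper) auto
  then show ?thesis using False max by (simp add: phi_star_def)
qed

lemma phi_star_nonneg: "\<phi> \<in> Phi_set \<Longrightarrow> 0 \<le> phi_star \<phi> a t"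
  by (simp add: phi_star_def Phi_set_def)

lemma phi_star_measurable: "\<phi> \<in> Phi_set \<Longrightarrow> phi_star \<phi> a \<in> borel_measurable borel"
  using Phi_set_measurable[of \<phi>] unfolding phi_star_def[abs_def] by measurable

context orlicz_family
begin

lemma psi_class_subset_orlicz_space:
  assumes "\<psi> \<in> Psi_set"
  shows "psi_class M \<psi> \<phi> \<tau> \<mu> \<Omega> \<subseteq> orlicz_space M"
proof
  fix f assume "f \<in> psi_class M \<psi> \<phi> \<tau> \<mu> \<Omega>"
  then obtain g where g: "g \<in> orlicz_space M" "psi_integral_of \<psi> g f" by (auto simp: psi_class_def)
  show "f \<in> orlicz_space M"
    using g(2) Psi_set_bounded[OF assms]
    by (intro orlicz_space_dominated[OF g(1)])
      (auto simp: psi_integral_of_def norm_mult intro!: mult_right_mono)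
qed

text \<open>The Bernstein type inequality. For a trigonometric polynomial \<open>f\<close> with frequencies in \<open>T\<close> the
  multiplier of the differences of its \<open>\<psi>\<close>-derivative is bounded by
  \<open>phi_star(n t) / \<bar>\<psi>(n)\<bar>\<close>; the frequency \<open>0\<close>, at which \<open>\<psi>\<close> may be small, is killed by
  \<open>\<phi>(0) = 0\<close>. Averaging and the hypothesis on the majorant, taken at \<open>\<xi> = n u / \<tau>\<close> so that
  \<open>u / \<xi> = \<tau> / n\<close>, give membership in the class. The bound on \<open>e\<close> is multiplicative so that it
  remains meaningful when the mean of \<open>\<phi>\<close> vanishes, in which case all \<open>e\<close> are admissible.\<close>

lemma ball_subset_psi_class:
  fixes \<tau> :: real and n :: nat
  assumes psi: "\<psi> \<in> Psi_set" "\<psi> (int n) \<noteq> 0"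
    and phi: "\<phi> \<in> Phi_set" "mono_on {0..a} \<phi>" "\<phi> a = (SUP t. \<phi> t)"
    and tau: "0 < \<tau>" "\<tau> \<le> a" and mu: "\<mu> \<in> weight_functions \<tau>" and n: "1 \<le> n"
    and Om: "0 < \<Omega> (\<tau> / n)"
    and cond: "\<And>\<xi> u. \<xi> > 0 \<Longrightarrow> 0 < u \<Longrightarrow> u \<le> a \<Longrightarrow>
           ennreal (\<Omega> (u / \<xi>)) *
             stieltjes_integral 0 (\<xi> * \<tau>) (\<lambda>t. ennreal (phi_star \<phi> a t)) (\<lambda>t. \<mu> (t / \<xi>))
           \<le> ennreal (\<Omega> u) * stieltjes_integral 0 \<tau> (\<lambda>t. ennreal (\<phi> t)) \<mu>"
    and T: "finite T" "\<And>k. k \<in> T \<Longrightarrow> \<bar>k\<bar> \<le> int n" "\<And>k. k \<in> T \<Longrightarrow> \<psi> k \<noteq> 0"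
    and e: "0 < e" "ennreal e * stieltjes_integral 0 \<tau> (\<lambda>t. ennreal (\<phi> t)) \<mu>
      \<le> ennreal ((\<mu> \<tau> - \<mu> 0) * cmod (\<psi> (int n)) * \<Omega> (\<tau> / n))"
  shows "scale_L1 (complex_of_real e) ` orlicz_ball M \<inter> L1.span (harmonic ` T)
    \<subseteq> psi_class M \<psi> \<phi> \<tau> \<mu> \<Omega>"
proof
  fix f assume f: "f \<in> scale_L1 (complex_of_real e) ` orlicz_ball M \<inter> L1.span (harmonic ` T)"
  then obtain y where y: "orlicz_norm M y \<le> 1" "f = scale_L1 (complex_of_real e) y"
    by (auto simp: orlicz_ball_def)
  have "orlicz_norm M f \<le> ennreal (cmod (complex_of_real e)) * orlicz_norm M y"
    unfolding y(2) by (rule orlicz_norm_scale_le)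
  also have "\<dots> \<le> ennreal e * 1" using e(1) y(1) by (intro mult_mono) auto
  finally have norm_f: "orlicz_norm M f \<le> ennreal e" by simp
  define g where "g = (\<Sum>k\<in>T. scale_L1 (fourier_coeff f k / \<psi> k) (harmonic k))"
  have g: "fourier_coeff g k = (if k \<in> T then fourier_coeff f k / \<psi> k else 0)" for k
    unfolding g_def by (rule fourier_coeff_harmonic_sum[OF T(1)])
  define p where "p = cmod (\<psi> (int n))"
  have p: "0 < p" using psi by (simp add: p_def)
  let ?D = "\<mu> \<tau> - \<mu> 0" and ?A = "stieltjes_integral 0 \<tau> (\<lambda>t. ennreal (\<phi> t)) \<mu>"
  have D: "0 < ?D" using weight_functions_increment_pos[OF mu tau(1)] by simp
  have mono: "mono_on {0..\<tau>} \<mu>" using mu by (simp add: weight_functions_def)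
  note [measurable] = phi_star_measurable[OF phi(1), of a]
  have modulus: "modulus M \<phi> g t \<le> ennreal (e / p) * ennreal (phi_star \<phi> a (n * t))" for t :: real
    unfolding modulus_def
  proof (rule SUP_least)
    fix h assume "h \<in> {h. \<bar>h\<bar> \<le> t}"
    then have h: "\<bar>h\<bar> \<le> t" by simp
    define s where "s = phi_star \<phi> a (n * t)"
    have s: "0 \<le> s" unfolding s_def by (rule phi_star_nonneg[OF phi(1)])
    have "Delta_norm M \<phi> h g \<le> ennreal (s / p) * orlicz_norm M f"
      unfolding Delta_norm_def orlicz_norm_def
    proof (rule orlicz_norm_seq_le_cmult)
      show "0 \<le> s / p" using s p by simp
      fix k
      show "cmod (complex_of_real (\<phi> (of_int k * h)) * fourier_coeff g k) \<le> s / p * cmod (fourier_coeff f k)"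
      proof (cases "k \<in> T \<and> k \<noteq> 0")
        case True
        then have k: "k \<in> T" "1 \<le> \<bar>k\<bar>" "\<bar>k\<bar> \<le> int n" using T(2)[of k] by auto
        have "\<phi> (of_int k * h) \<le> s"
          unfolding s_def Phi_set_abs[OF phi(1), of k h]
          using h k(3) by (intro Phi_set_le_phi_star phi mult_mono) auto
        moreover have "cmod (\<psi> (int n)) \<le> cmod (\<psi> \<bar>k\<bar>)"
          using Psi_set_antimono[OF psi(1) k(2), of "int n"] k(3) by simp
        moreover have "cmod (\<psi> \<bar>k\<bar>) = cmod (\<psi> k)"
          using psi(1) k(2) by (cases "0 \<le> k") (auto simp: Psi_set_def)
        ultimately have "\<phi> (of_int k * h) / cmod (\<psi> k) \<le> s / p"
          using s p by (intro frac_le) (auto simp: p_def)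
        then have "\<phi> (of_int k * h) / cmod (\<psi> k) * cmod (fourier_coeff f k) \<le> s / p * cmod (fourier_coeff f k)"
          by (rule mult_right_mono) simp
        moreover have "0 \<le> \<phi> (of_int k * h)" using phi(1) by (simp add: Phi_set_def)
        ultimately show ?thesis using k(1) by (simp add: g norm_mult norm_divide)
      next
        case False
        then show ?thesis using phi(1) s p by (auto simp: g Phi_set_def)
      qed
    qed
    also have "\<dots> \<le> ennreal (s / p) * ennreal e" using norm_f by (rule mult_left_mono) simp
    also have "\<dots> = ennreal (e / p) * ennreal s"
      using s p e(1) by (simp add: ennreal_mult[symmetric] mult.commute)
    finally show "Delta_norm M \<phi> h g \<le> ennreal (e / p) * ennreal (phi_star \<phi> a (n * t))"
      by (simp add: s_def)
  qed
  have "mean_modulus M \<phi> g \<tau> \<mu> u \<le> ennreal (\<Omega> u)" if u: "0 < u" "u \<le> \<tau>" for u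
  proof -
    define \<xi> where "\<xi> = n * u / \<tau>"
    have xi: "0 < \<xi>" "u / \<xi> = \<tau> / n" "\<xi> * \<tau> = n * u" using u n tau by (auto simp: \<xi>_def)
    define J where "J = stieltjes_integral 0 \<tau> (\<lambda>t. ennreal (phi_star \<phi> a (\<xi> * t))) \<mu>"
    have "stieltjes_integral (\<xi> * 0) (\<xi> * \<tau>) (\<lambda>t. ennreal (phi_star \<phi> a t)) (\<lambda>t. \<mu> (t / \<xi>)) = J"
      unfolding J_def using xi tau mono by (intro stieltjes_integral_scale) auto
    then have J: "ennreal (\<Omega> (\<tau> / n)) * J \<le> ennreal (\<Omega> u) * ?A"
      using cond[of \<xi> u] xi u tau by simp
    have "ennreal ?D * mean_modulus M \<phi> g \<tau> \<mu> u
        = stieltjes_integral 0 u (modulus M \<phi> g) (\<lambda>t. \<mu> (\<tau> * t / u))"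
      using D by (rule stieltjes_integral_modulus_eq[symmetric])
    also have "\<dots> \<le> stieltjes_integral 0 u (\<lambda>t. ennreal (e / p) * ennreal (phi_star \<phi> a (n * t))) (\<lambda>t. \<mu> (\<tau> * t / u))"
      by (intro stieltjes_integral_mono modulus)
    also have "\<dots> = stieltjes_integral (u / \<tau> * 0) (u / \<tau> * \<tau>)
        (\<lambda>t. ennreal (e / p) * ennreal (phi_star \<phi> a (n * t))) (\<lambda>t. \<mu> (t / (u / \<tau>)))"
      using tau by (simp add: mult.commute)
    also have "\<dots> = stieltjes_integral 0 \<tau> (\<lambda>t. ennreal (e / p) * ennreal (phi_star \<phi> a (n * (u / \<tau> * t)))) \<mu>"
      using u tau mono by (intro stieltjes_integral_scale) auto
    also have "\<dots> = ennreal (e / p) * stieltjes_integral 0 \<tau> (\<lambda>t. ennreal (phi_star \<phi> a (n * (u / \<tau> * t)))) \<mu>"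
      by (intro stieltjes_integral_cmult) measurable
    also have "\<dots> = ennreal (e / p) * J"
      by (simp add: J_def \<xi>_def mult.assoc)
    finally have le: "ennreal ?D * mean_modulus M \<phi> g \<tau> \<mu> u \<le> ennreal (e / p) * J" .
    \<comment> \<open>The claim is proved after multiplication by \<open>w > 0\<close>, to avoid dividing by the mean of \<open>\<phi>\<close>.\<close>
    define w where "w = p * ?D * \<Omega> (\<tau> / n)"
    have w: "0 < w" using p D Om by (simp add: w_def)
    have "ennreal w * mean_modulus M \<phi> g \<tau> \<mu> u
        = ennreal (\<Omega> (\<tau> / n)) * (ennreal p * (ennreal ?D * mean_modulus M \<phi> g \<tau> \<mu> u))"
      using p D Om by (simp add: w_def ennreal_mult mult_ac)
    also have "\<dots> \<le> ennreal (\<Omega> (\<tau> / n)) * (ennreal p * (ennreal (e / p) * J))"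
      using le by (intro mult_left_mono) auto
    also have "ennreal p * (ennreal (e / p) * J) = ennreal e * J"
      using p e(1) by (simp add: mult.assoc[symmetric] ennreal_mult'[symmetric])
    also have "ennreal (\<Omega> (\<tau> / n)) * (ennreal e * J) = ennreal e * (ennreal (\<Omega> (\<tau> / n)) * J)"
      by (simp add: mult_ac)
    also have "\<dots> \<le> ennreal e * (ennreal (\<Omega> u) * ?A)"
      using J by (rule mult_left_mono) simp
    also have "\<dots> = ennreal (\<Omega> u) * (ennreal e * ?A)" by (simp add: mult_ac)
    also have "\<dots> \<le> ennreal (\<Omega> u) * ennreal w"
      using e(2) by (intro mult_left_mono) (simp_all add: w_def p_def mult_ac)
    finally have "ennreal w * mean_modulus M \<phi> g \<tau> \<mu> u \<le> ennreal w * ennreal (\<Omega> u)"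
      by (simp add: mult.commute)
    then show ?thesis using w by (simp add: ennreal_mult_le_mult_iff)
  qed
  moreover have "g \<in> orlicz_space M"
    by (rule orlicz_space_finite_support[OF T(1)]) (simp add: g)
  moreover have "psi_integral_of \<psi> g f"
    using T(3) f fourier_coeff_span_eq_0[OF T(1)] by (auto simp: psi_integral_of_def g)
  ultimately show "f \<in> psi_class M \<psi> \<phi> \<tau> \<mu> \<Omega>" by (auto simp: psi_class_def)
qed

end

text \<open>The quotient is the supremum of the reals \<open>e\<close> with \<open>e A \<le> d\<close>, also for \<open>A = 0\<close>
  and \<open>A = \<infinity>\<close>.\<close>

lemma ennreal_divide_le_of_reals:
  assumes "\<And>e. 0 < e \<Longrightarrow> ennreal e * A \<le> ennreal d \<Longrightarrow> ennreal e \<le> P" and "0 < d"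
  shows "ennreal d / A \<le> P"
proof (cases A)
  case (real r)
  show ?thesis
  proof (cases "r = 0")
    case True
    then have le: "ennreal (real m) \<le> P" for m
      using assms(1)[of "real m"] real by (cases "m = 0") auto
    have "P = top"
    proof (rule ccontr)
      assume "P \<noteq> top"
      then obtain p where p: "P = ennreal p" "0 \<le> p" by (cases P) auto
      obtain m :: nat where "p < real m" using reals_Archimedean2 by blast
      then show False using le[of m] p by simp
    qed
    then show ?thesis by simp
  next
    case False
    then show ?thesis
      using assms(1)[of "d / r"] assms(2) real by (simp add: divide_ennreal ennreal_mult'[symmetric])
  qed
qed simp

section \<open>The widths of the class\<close>

theorem theorem3p3:
  fixes M :: "int \<Rightarrow> real \<Rightarrow> real"
    and \<psi> :: "int \<Rightarrow> complex"
    and \<phi> \<mu> \<Omega> :: "real \<Rightarrow> real"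
    and a \<tau> :: real
    and n N :: nat
    and P :: "(int \<Rightarrow> real \<Rightarrow> real) \<Rightarrow> nat \<Rightarrow> per_L1 set \<Rightarrow> ennreal"
  assumes "\<And>k. orlicz_function (M k)"
    and "\<And>k. conjugate (M k) 1 = 1"
    and "\<And>k v. v > 1 \<Longrightarrow> conjugate (M k) v > conjugate (M k) 1"
    and "\<psi> \<in> Psi_set"
    and "\<phi> \<in> Phi_set"
    and "a > 0"
    and "mono_on {0..a} \<phi>"
    and "\<phi> a = (SUP t. \<phi> t)"
    and "\<tau> \<in> {0<..a}"
    and "\<mu> \<in> weight_functions \<tau>"
    and "continuous_on {0..} \<Omega>"
    and "strict_mono_on {0..} \<Omega>"
    and "\<Omega> 0 = 0"
    and "\<And>\<xi> u. \<xi> > 0 \<Longrightarrow> 0 < u \<Longrightarrow> u \<le> a \<Longrightarrow>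
           ennreal (\<Omega> (u / \<xi>)) *
             stieltjes_integral 0 (\<xi> * \<tau>) (\<lambda>t. ennreal (phi_star \<phi> a t)) (\<lambda>t. \<mu> (t / \<xi>))
           \<le> ennreal (\<Omega> u) * stieltjes_integral 0 \<tau> (\<lambda>t. ennreal (\<phi> t)) \<mu>"
    and "n \<ge> 1"
    and "N \<in> {2 * n - 1, 2 * n}"
    and "P \<in> {bernstein_width, kolmogorov_width, linear_width, projection_width}"
  shows "P M N (psi_class M \<psi> \<phi> \<tau> \<mu> \<Omega>)
           \<le> ennreal (\<mu> \<tau> - \<mu> 0) / I_inf n \<phi> \<tau> \<mu>
              * ennreal (cmod (\<psi> (int n))) * ennreal (\<Omega> (\<tau> / real n))
       \<and> (N = 2 * n - 1 \<or> \<psi> 0 \<noteq> 0 \<longrightarrow>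
            ennreal (\<mu> \<tau> - \<mu> 0) / stieltjes_integral 0 \<tau> (\<lambda>t. ennreal (\<phi> t)) \<mu>
              * ennreal (cmod (\<psi> (int n))) * ennreal (\<Omega> (\<tau> / real n))
            \<le> P M N (psi_class M \<psi> \<phi> \<tau> \<mu> \<Omega>)
          \<and> (I_inf n \<phi> \<tau> \<mu> = stieltjes_integral 0 \<tau> (\<lambda>t. ennreal (\<phi> t)) \<mu> \<longrightarrow>
              P M N (psi_class M \<psi> \<phi> \<tau> \<mu> \<Omega>) =
                ennreal (\<mu> \<tau> - \<mu> 0) / stieltjes_integral 0 \<tau> (\<lambda>t. ennreal (\<phi> t)) \<mu>
                  * ennreal (cmod (\<psi> (int n))) * ennreal (\<Omega> (\<tau> / real n))))"
proof -
  interpret orlicz_family M by standard (use assms(1,2) in auto)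
  let ?K = "psi_class M \<psi> \<phi> \<tau> \<mu> \<Omega>"
    and ?A = "stieltjes_integral 0 \<tau> (\<lambda>t. ennreal (\<phi> t)) \<mu>"
    and ?p = "cmod (\<psi> (int n))" and ?D = "\<mu> \<tau> - \<mu> 0" and ?w = "\<Omega> (\<tau> / real n)"
  let ?upper = "ennreal ?D / I_inf n \<phi> \<tau> \<mu> * ennreal ?p * ennreal ?w"
  let ?lower = "ennreal ?D / ?A * ennreal ?p * ennreal ?w"
  have tau: "0 < \<tau>" "\<tau> \<le> a" using assms(9) by auto
  have n: "1 \<le> n" by fact
  have D: "0 < ?D" using weight_functions_increment_pos[OF assms(10) tau(1)] by simp
  have w: "0 < ?w"
    using strict_mono_onD[OF assms(12), of 0 "\<tau> / n"] assms(13) tau n by simp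
  have K: "?K \<subseteq> orlicz_space M" by (rule psi_class_subset_orlicz_space[OF assms(4)])
  have N: "N = 2 * n - 1 \<or> N = 2 * n" using assms(16) by auto

  have tail: "orlicz_norm M f' \<le> ?upper"
    if "f \<in> ?K" and "\<And>k. fourier_coeff f' k = 0 \<or> int n \<le> \<bar>k\<bar> \<and> fourier_coeff f' k = fourier_coeff f k"
    for f f'
    unfolding orlicz_norm_def
    by (rule psi_class_tail_le[OF assms(4,5,10) tau(1) n w that])

  \<comment> \<open>\<open>N\<close> consecutive frequencies from \<open>1 - n\<close> to \<open>n - 1\<close> or, if \<open>N = 2 n\<close>, to \<open>n\<close>; all others have
    modulus at least \<open>n\<close>.\<close>
  define T where "T = {1 - int n..int N - int n}"
  have T: "finite T" "card T = N" "\<And>k. k \<notin> T \<Longrightarrow> int n \<le> \<bar>k\<bar>"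
    using n N by (auto simp: T_def)
  have proj_upper: "projection_width M N ?K \<le> ?upper"
  proof (rule projection_width_le[OF T(1,2)])
    fix f assume "f \<in> ?K"
    then show "orlicz_norm M (f - partial_sum T f) \<le> ?upper"
      by (rule tail) (use T in \<open>auto simp: fourier_coeff_diff fourier_coeff_partial_sum\<close>)
  qed
  have bern_upper: "bernstein_width M N ?K \<le> ?upper"
  proof (rule bernstein_width_le[OF T(1)])
    show "card T \<le> N" by (simp add: T)
    fix f assume "f \<in> ?K" and "\<And>k. k \<in> T \<Longrightarrow> fourier_coeff f k = 0"
    then show "orlicz_norm M f \<le> ?upper" by (intro tail[of f]) (use T(3) in auto)
  qed
  have kol_lin: "kolmogorov_width M N ?K \<le> linear_width M N ?K"
    by (rule kolmogorov_le_linear_width[OF K])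
  have lin_proj: "linear_width M N ?K \<le> projection_width M N ?K"
    by (rule linear_le_projection_width)
  have upper: "P M N ?K \<le> ?upper"
    using assms(17) proj_upper bern_upper kol_lin lin_proj by auto

  have lower: "?lower \<le> P M N ?K" if zero: "N = 2 * n - 1 \<or> \<psi> 0 \<noteq> 0"
  proof (cases "?p = 0")
    case False
    then have p: "0 < ?p" by simp
    \<comment> \<open>\<open>N + 1\<close> frequencies of modulus at most \<open>n\<close>, without \<open>0\<close> if \<open>N = 2 n - 1\<close>, where \<open>\<psi>(0)\<close> may
      be zero.\<close>
    define U where "U = (if N = 2 * n then {- int n..int n} else {- int n..int n} - {0})"
    have "card {- int n..int n} = 2 * n + 1" "card ({- int n..int n} - {0}) = 2 * n"
      by (simp_all add: card_Diff_singleton)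
    then have U: "finite U" "card U = N + 1" "\<And>k. k \<in> U \<Longrightarrow> \<bar>k\<bar> \<le> int n"
      using N n by (auto simp: U_def split: if_splits)
    have psi_U: "\<psi> k \<noteq> 0" if "k \<in> U" for k
    proof (cases "k = 0")
      case True
      then show ?thesis using that zero n by (auto simp: U_def split: if_splits)
    next
      case False
      then have "?p \<le> cmod (\<psi> \<bar>k\<bar>)"
        using U(3)[OF that] by (intro Psi_set_antimono assms(4)) auto
      moreover have "cmod (\<psi> \<bar>k\<bar>) = cmod (\<psi> k)"
        using assms(4) False by (cases "0 \<le> k") (auto simp: Psi_set_def)
      ultimately show ?thesis using p by auto
    qed
    have "ennreal e \<le> P M N ?K" if e: "0 < e" "ennreal e * ?A \<le> ennreal (?D * ?p * ?w)" for e
    proof -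
      have sub: "scale_L1 (complex_of_real e) ` orlicz_ball M \<inter> L1.span (harmonic ` U) \<subseteq> ?K"
        using False
        by (intro ball_subset_psi_class[OF assms(4) _ assms(5,7,8) tau assms(10) n w assms(14) U(1,3) psi_U e]) auto
      have "ennreal e \<le> bernstein_width M N ?K" "ennreal e \<le> kolmogorov_width M N ?K"
        by (rule le_bernstein_width[OF U(1,2) e(1) sub] le_kolmogorov_width[OF U(1,2) e(1) sub])+
      then show ?thesis
        using assms(17) kol_lin lin_proj by auto
    qed
    then have "ennreal (?D * ?p * ?w) / ?A \<le> P M N ?K"
      using D p w by (intro ennreal_divide_le_of_reals) auto
    then show ?thesis using D p w by (simp add: ennreal_mult divide_ennreal_def mult_ac)
  qed simp

  show ?thesis
    using upper lower by (auto intro: antisym)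
qed

end
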